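(* Let $\lambda_0>0$ and let $f^\delta\in L^\infty(\Omega)$ be such that $\inf_\Omega f^\delta>0$. Then there exists at least one solution $w\in BV(\Omega)$ of the problem $$\min_{w}\left\{\lambda_0\int_\Omega\left(f^\delta e^{-w}-1\right)^2+TV(w)\right\}$$ such that $\inf_\Omega\log f^\delta\le w\le\sup_\Omega\log f^\delta$ a.e. in $\Omega$.
   Context: $\Omega\subseteq\mathbb{R}^2$ is a domain of finite measure, $BV(\Omega)$ is the space of functions of bounded variation on $\Omega$, $TV$ is the total variation, and the minimization is over $BV(\Omega)$. Infima and suprema of functions over $\Omega$ are essential infima and suprema. *)

theory Defs
  imports "HOL-Analysis.Analysis" "HOL-Probability.Essential_Supremum"
begin

text \<open>The dual of \<^const>\<open>esssup\<close>, with the dual convention for non-measurable functions.\<close>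

definition essinf ::
  "'a measure \<Rightarrow> ('a \<Rightarrow> 'b::{second_countable_topology, dense_linorder, linorder_topology, complete_linorder}) \<Rightarrow> 'b"
  where "essinf M f = (if f \<in> borel_measurable M then Liminf (ae_filter M) f else bot)"

definition L_infinity :: "'a measure \<Rightarrow> ('a \<Rightarrow> real) set"
  where "L_infinity M = {f \<in> borel_measurable M. esssup M (\<lambda>x. ereal \<bar>f x\<bar>) < \<infinity>}"

definition C1_compactly_supported ::
  "'a::euclidean_space set \<Rightarrow> ('a \<Rightarrow> 'b::real_normed_vector) set"
  where "C1_compactly_supported \<Omega> =
    {\<phi>. (\<exists>\<phi>'. (\<forall>x. (\<phi> has_derivative blinfun_apply (\<phi>' x)) (at x)) \<and> continuous_on UNIV \<phi>') \<and>
         compact (closure {x. \<phi> x \<noteq> 0}) \<and> closure {x. \<phi> x \<noteq> 0} \<subseteq> \<Omega>}"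

definition divergence :: "('a::euclidean_space \<Rightarrow> 'a) \<Rightarrow> 'a \<Rightarrow> real"
  where "divergence \<phi> x = (\<Sum>b\<in>Basis. frechet_derivative \<phi> (at x) b \<bullet> b)"

text \<open>The set of test fields is closed under negation and contains 0, so truncating negative
  integrals to 0 with \<^const>\<open>ennreal\<close> does not change the supremum. The definition is meant for
  integrable \<open>w\<close>; the integral of a non-integrable function is 0 by convention.\<close>

definition TV :: "'a::euclidean_space set \<Rightarrow> ('a \<Rightarrow> real) \<Rightarrow> ennreal"
  where "TV \<Omega> w =
    (SUP \<phi> \<in> {\<phi> \<in> C1_compactly_supported \<Omega>. \<forall>x. norm (\<phi> x) \<le> 1}.
       ennreal (\<integral>x. w x * divergence \<phi> x \<partial>lebesgue_on \<Omega>))"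

text \<open>Elements are functions rather than almost-everywhere classes; their values outside
  \<open>\<Omega>\<close> are irrelevant.\<close>

definition BV :: "'a::euclidean_space set \<Rightarrow> ('a \<Rightarrow> real) set"
  where "BV \<Omega> = {w. integrable (lebesgue_on \<Omega>) w \<and> TV \<Omega> w < \<infinity>}"

text \<open>The integral is a nonnegative Lebesgue integral, since it can be infinite for \<open>w\<close> in
  \<open>BV \<Omega>\<close> that are not bounded below.\<close>

definition log_energy ::
  "'a::euclidean_space set \<Rightarrow> real \<Rightarrow> ('a \<Rightarrow> real) \<Rightarrow> ('a \<Rightarrow> real) \<Rightarrow> ennreal"
  where "log_energy \<Omega> l f w =
    ennreal l * (\<integral>\<^sup>+x. ennreal ((f x * exp (- w x) - 1)\<^sup>2) \<partial>lebesgue_on \<Omega>) + TV \<Omega> w"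

end

theory Submission
  imports Defs "HOL-Complex_Analysis.Great_Picard"
begin

text \<open>
  Direct method. Truncating a competitor to the range \<open>[a, b]\<close> of \<open>ln f\<close> increases neither the data
  term nor the total variation, so a minimizing sequence may be taken with values in \<open>[a, b]\<close>. It is
  then bounded in \<open>L\<^sup>\<infinity>\<close> with bounded total variation, a subsequence converges almost everywhere, and
  the energy is lower semicontinuous along it by Fatou's lemma. The data term is not convex, so
  weak convergence would not suffice.

  Both facts about the total variation rest on the same estimate: on a compact subset of \<open>\<Omega>\<close>, the
  \<open>L\<^sup>1\<close> distance of \<open>u\<close> to its mollification at scale \<open>e\<close> is at most \<open>e\<close> times the variation of \<open>u\<close>.
  It reduces truncation to the chain rule for smooth functions and makes the mollifications, which
  converge along a diagonal subsequence, a uniform approximation of the sequence in \<open>L\<^sup>1\<close>.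
\<close>

section \<open>Averages of compactly supported functions\<close>

text \<open>Total variation is available only as a supremum over C1 test fields; no gradient measure
  is constructed. Every estimate therefore comes from exhibiting a field that is C1, supported in
  \<Omega> and bounded by 1. Such fields are produced by averaging compactly supported C1 functions,
  hence the calculus of averages at the start. Since no regularity of the boundary of \<Omega> is
  assumed, extension across it is not an option: mollification is controlled only on compact sets
  with a margin inside \<Omega>, and the remainder is absorbed by the uniform bound times a small
  measure. This is why truncation has to precede compactness. The truncation is not C1 either, so
  both it and the truncated function are smoothed before the chain rule is applied.\<close>

text \<open>Gradients as vector fields avoid operator-valued integrals; a vector field is treated through its components.\<close>

definition C1_grad :: "('a::euclidean_space \<Rightarrow> real) \<Rightarrow> ('a \<Rightarrow> 'a) \<Rightarrow> bool"
  where "C1_grad k G \<longleftrightarrow>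
    (\<forall>x. (k has_derivative (\<lambda>u. G x \<bullet> u)) (at x)) \<and> continuous_on UNIV G"

lemma C1_gradD:
  assumes "C1_grad k G"
  shows C1_grad_derivative: "(k has_derivative (\<lambda>u. G x \<bullet> u)) (at x)"
    and C1_grad_continuous: "continuous_on S k"
    and C1_grad_continuous_grad: "continuous_on S G"
proof -
  show d: "(k has_derivative (\<lambda>u. G x \<bullet> u)) (at x)" for x
    using assms unfolding C1_grad_def by blast
  show "continuous_on S k"
    using d by (intro continuous_at_imp_continuous_on ballI has_derivative_continuous)
  show "continuous_on S G"
    using assms continuous_on_subset unfolding C1_grad_def by blast
qed

lemma C1_grad_unique_at:
  assumes "C1_grad k G" "(k has_derivative D) (at x)"
  shows "D = (\<lambda>u. G x \<bullet> u)"
  using has_derivative_unique[OF assms(2) C1_grad_derivative[OF assms(1)]] .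

lemma C1_grad_zero_outside:
  assumes "C1_grad k G" "closed K" "\<And>x. x \<notin> K \<Longrightarrow> k x = 0" "x \<notin> K"
  shows "G x = 0"
proof -
  have "(k has_derivative (\<lambda>u. 0)) (at x)"
    by (rule has_derivative_transform_within_open[where f="\<lambda>_. 0" and s="-K"]) (use assms in auto)
  from C1_grad_unique_at[OF assms(1) this] have "0 = G x \<bullet> G x" by meson
  then show ?thesis by simp
qed

lemma bounded_continuous_compact_support:
  fixes G :: "'a::euclidean_space \<Rightarrow> 'b::real_normed_vector"
  assumes "continuous_on UNIV G" "compact K" "\<And>x. x \<notin> K \<Longrightarrow> G x = 0"
  obtains B where "B > 0" "\<And>x. norm (G x) \<le> B"
proof -
  have "bounded (G ` K)"
    by (intro compact_imp_bounded compact_continuous_image continuous_on_subset[OF assms(1)] assms) auto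
  then obtain B where "B > 0" "\<And>x. x \<in> K \<Longrightarrow> norm (G x) \<le> B"
    unfolding bounded_pos by auto
  then have "norm (G x) \<le> B" for x
    using assms(3)[of x] by (cases "x \<in> K") auto
  with \<open>B > 0\<close> that show thesis by blast
qed

lemma uniformly_continuous_compact_support:
  fixes G :: "'a::euclidean_space \<Rightarrow> 'b::real_normed_vector"
  assumes "continuous_on UNIV G" "compact K" "\<And>x. x \<notin> K \<Longrightarrow> G x = 0" "e > 0"
  obtains d where "d > 0" "\<And>x y :: 'a. dist x y < d \<Longrightarrow> dist (G x) (G y) < e"
proof -
  \<comment> \<open>The unit margin puts both of two points at distance below 1 into
    \<open>?K\<close> as soon as one of them is in \<open>K\<close>; otherwise both values are
    0.\<close>
  let ?K = "\<Union>x\<in>K. cball x 1"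
  have "uniformly_continuous_on ?K G"
    by (intro compact_uniformly_continuous continuous_on_subset[OF assms(1)]
        compact_minkowski_sum_cball assms) auto
  then obtain d where d: "d > 0" "\<And>x y. x \<in> ?K \<Longrightarrow> y \<in> ?K \<Longrightarrow> dist x y < d \<Longrightarrow> dist (G x) (G y) < e"
    unfolding uniformly_continuous_on_def using \<open>e > 0\<close> by metis
  show thesis
  proof (rule that[of "min d 1"])
    fix x y :: 'a assume xy: "dist x y < min d 1"
    show "dist (G x) (G y) < e"
    proof (cases "x \<in> K \<or> y \<in> K")
      case True
      then obtain z where "z \<in> K" "x \<in> cball z 1" "y \<in> cball z 1"
        using xy by (metis centre_in_cball dist_commute less_eq_real_def mem_cball min_less_iff_conj zero_le_one)
      then have "x \<in> ?K" "y \<in> ?K" by blast+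
      with d(2) xy show ?thesis by simp
    qed (use assms in auto)
  qed (use d in auto)
qed

text \<open>Mean value inequality for \<open>k\<close> minus its linear part at \<open>z\<close>,
  whose gradient is smaller than \<open>e\<close> on the ball. The error is uniform in
  \<open>z\<close>, which is what differentiation under an integral requires.\<close>

lemma C1_grad_linearization:
  fixes k :: "'a::euclidean_space \<Rightarrow> real"
  assumes k: "C1_grad k G" and d: "\<And>x y. dist x y < d \<Longrightarrow> dist (G x) (G y) < e" and u: "norm u < d"
  shows "\<bar>k (z + u) - k z - G z \<bullet> u\<bar> \<le> e * norm u"
proof -
  let ?f = "\<lambda>x. k x - G z \<bullet> x"
  have "norm (?f (z + u) - ?f z) \<le> e * norm (z + u - z)"
  proof (rule differentiable_bound[where S="ball z d" and f'="\<lambda>x v. G x \<bullet> v - G z \<bullet> v"])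
    fix x assume x: "x \<in> ball z d"
    show "(?f has_derivative (\<lambda>v. G x \<bullet> v - G z \<bullet> v)) (at x within ball z d)"
      by (intro derivative_intros has_derivative_at_withinI[OF C1_grad_derivative[OF k]])
    show "onorm (\<lambda>v. G x \<bullet> v - G z \<bullet> v) \<le> e"
    proof (rule onorm_le)
      fix v
      have "norm ((G x - G z) \<bullet> v) \<le> norm (G x - G z) * norm v" by (simp add: Cauchy_Schwarz_ineq2)
      also have "\<dots> \<le> e * norm v"
        using d[of x z] x by (intro mult_right_mono) (auto simp: dist_norm norm_minus_commute)
      finally show "norm (G x \<bullet> v - G z \<bullet> v) \<le> e * norm v" by (simp add: inner_diff_left)
    qed
  qed (use u in \<open>auto simp: dist_norm intro: le_less_trans[OF norm_ge_zero]\<close>)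
  then show ?thesis by (simp add: inner_add_right algebra_simps)
qed

lemma integrable_bounded_mult:
  fixes f :: "'a \<Rightarrow> 'b::{banach, second_countable_topology}" and w :: "'a \<Rightarrow> real"
  assumes "integrable M w" "f \<in> borel_measurable M" "\<And>x. norm (f x) \<le> B"
  shows "integrable M (\<lambda>x. w x *\<^sub>R f x)"
proof (rule Bochner_Integration.integrable_bound[where f="\<lambda>x. B * w x"])
  have "0 \<le> B" using assms(3) norm_ge_zero order_trans by blast
  then show "AE x in M. norm (w x *\<^sub>R f x) \<le> norm (B * w x)"
    using assms(3) by (auto simp: abs_mult mult.commute[of B] intro!: mult_left_mono)
qed (use assms in auto)

lemma norm_integral_weighted_le:
  fixes f :: "'a \<Rightarrow> 'b::{banach, second_countable_topology}" and w :: "'a \<Rightarrow> real"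
  assumes "integrable M w" "f \<in> borel_measurable M" "\<And>x. norm (f x) \<le> B"
  shows "norm (\<integral>x. w x *\<^sub>R f x \<partial>M) \<le> (\<integral>x. \<bar>w x\<bar> \<partial>M) * B"
proof -
  have "norm (\<integral>x. w x *\<^sub>R f x \<partial>M) \<le> (\<integral>x. norm (w x *\<^sub>R f x) \<partial>M)"
    by (rule integral_norm_bound)
  also have "\<dots> \<le> (\<integral>x. \<bar>w x\<bar> * B \<partial>M)"
    using assms integrable_norm[OF integrable_bounded_mult[OF assms]]
    by (intro Bochner_Integration.integral_mono) (auto intro!: mult_left_mono)
  finally show ?thesis by simp
qed

text \<open>Compact support makes \<open>G\<close> uniformly continuous, so the linearization error
  is uniform in \<open>y\<close> and can be integrated against \<open>\<bar>w\<bar>\<close>. The map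
  \<open>g\<close> unites three uses: \<open>g y = y\<close> for averages over a set,
  \<open>g y = - y\<close> for convolutions, and \<open>g t = - (t *\<^sub>R h)\<close> for averages
  along a segment.\<close>

lemma C1_grad_average:
  fixes k :: "'a::euclidean_space \<Rightarrow> real" and g :: "'b \<Rightarrow> 'a"
  assumes k: "C1_grad k G" and K: "compact K" "\<And>x. x \<notin> K \<Longrightarrow> k x = 0"
    and w: "integrable M w" and g[measurable]: "g \<in> borel_measurable M"
  shows "C1_grad (\<lambda>x. \<integral>y. w y * k (x + g y) \<partial>M) (\<lambda>x. \<integral>y. w y *\<^sub>R G (x + g y) \<partial>M)"
    and "integrable M (\<lambda>y. w y * k (x + g y))" and "integrable M (\<lambda>y. w y *\<^sub>R G (x + g y))"
proof -
  note [measurable] = borel_measurable_integrable[OF w]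
  have [measurable]: "k \<in> borel_measurable borel" "G \<in> borel_measurable borel"
    using k by (auto intro!: borel_measurable_continuous_onI C1_gradD)
  have G0: "x \<notin> K \<Longrightarrow> G x = 0" for x
    using C1_grad_zero_outside[OF k compact_imp_closed[OF K(1)] K(2)] by blast
  obtain B where B: "\<And>x. norm (k x) \<le> B"
    using bounded_continuous_compact_support[OF C1_grad_continuous[OF k] K] by metis
  obtain B' where B': "\<And>x. norm (G x) \<le> B'"
    using bounded_continuous_compact_support[OF C1_grad_continuous_grad[OF k] K(1) G0] by metis
  have i: "integrable M (\<lambda>y. w y * k (x + g y))" for x
    using integrable_bounded_mult[OF w, of "\<lambda>y. k (x + g y)" B] B by simp
  have I: "integrable M (\<lambda>y. w y *\<^sub>R G (x + g y))" for x
    by (rule integrable_bounded_mult[OF w _ B']) simp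
  show "integrable M (\<lambda>y. w y * k (x + g y))" "integrable M (\<lambda>y. w y *\<^sub>R G (x + g y))"
    by fact+
  define W where "W = (\<integral>y. \<bar>w y\<bar> \<partial>M)"
  have W: "W \<ge> 0" unfolding W_def by simp
  \<comment> \<open>Dividing by \<open>W + 1\<close> instead of \<open>W\<close> covers a weight
    that vanishes almost everywhere.\<close>
  have Ucont: "\<exists>d>0. \<forall>x y. dist x y < d \<longrightarrow> dist (G x) (G y) < e / (W + 1)" if "e > 0" for e
  proof -
    have "e / (W + 1) > 0" using that W by simp
    from uniformly_continuous_compact_support[OF C1_grad_continuous_grad[OF k] K(1) G0 this]
    show ?thesis by metis
  qed
  have We: "W * (e / (W + 1)) \<le> e" if "e > 0" for e
    using that W by (simp add: field_simps)
  show "C1_grad (\<lambda>x. \<integral>y. w y * k (x + g y) \<partial>M) (\<lambda>x. \<integral>y. w y *\<^sub>R G (x + g y) \<partial>M)"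
    unfolding C1_grad_def
  proof (intro conjI allI)
    fix x
    show "((\<lambda>x. \<integral>y. w y * k (x + g y) \<partial>M) has_derivative (\<lambda>u. (\<integral>y. w y *\<^sub>R G (x + g y) \<partial>M) \<bullet> u)) (at x)"
      unfolding has_derivative_at_alt
    proof (intro conjI allI impI bounded_linear_inner_right)
      fix e :: real assume "e > 0"
      then obtain d where d: "d > 0" "\<And>x y. dist x y < d \<Longrightarrow> dist (G x) (G y) < e / (W + 1)"
        using Ucont by metis
      show "\<exists>d>0. \<forall>y. norm (y - x) < d \<longrightarrow>
          norm ((\<integral>z. w z * k (y + g z) \<partial>M) - (\<integral>z. w z * k (x + g z) \<partial>M) - (\<integral>z. w z *\<^sub>R G (x + g z) \<partial>M) \<bullet> (y - x))
          \<le> e * norm (y - x)"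
      proof (intro exI[of _ d] conjI allI impI d)
        fix y assume y: "norm (y - x) < d"
        let ?r = "\<lambda>z. k (y + g z) - k (x + g z) - G (x + g z) \<bullet> (y - x)"
        have r: "\<bar>?r z\<bar> \<le> e / (W + 1) * norm (y - x)" for z
          using C1_grad_linearization[OF k d(2) y, of "x + g z"] by (simp add: algebra_simps)
        have iG: "integrable M (\<lambda>z. w z * (G (x + g z) \<bullet> (y - x)))"
          using integrable_inner_left[OF I] by simp

        have "(\<integral>z. w z * k (y + g z) \<partial>M) - (\<integral>z. w z * k (x + g z) \<partial>M) - (\<integral>z. w z *\<^sub>R G (x + g z) \<partial>M) \<bullet> (y - x)
            = (\<integral>z. w z * k (y + g z) \<partial>M) - (\<integral>z. w z * k (x + g z) \<partial>M) - (\<integral>z. (w z *\<^sub>R G (x + g z)) \<bullet> (y - x) \<partial>M)"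
          using I by (subst integral_inner_left) auto
        also have "\<dots> = (\<integral>z. w z * ?r z \<partial>M)"
          using i I by (simp add: right_diff_distrib iG)
        also have "norm \<dots> \<le> W * (e / (W + 1)) * norm (y - x)"
          using norm_integral_weighted_le[OF w, of ?r "e / (W + 1) * norm (y - x)", folded W_def] r
          by (simp add: mult.assoc)
        also have "\<dots> \<le> e * norm (y - x)"
          by (intro mult_right_mono We \<open>e > 0\<close>) auto
        finally show "norm ((\<integral>z. w z * k (y + g z) \<partial>M) - (\<integral>z. w z * k (x + g z) \<partial>M) - (\<integral>z. w z *\<^sub>R G (x + g z) \<partial>M) \<bullet> (y - x))
          \<le> e * norm (y - x)" .
      qed
    qed
  next
    show "continuous_on UNIV (\<lambda>x. \<integral>y. w y *\<^sub>R G (x + g y) \<partial>M)"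
      unfolding continuous_on_iff
    proof (intro ballI allI impI)
      fix x :: 'a and e :: real assume "e > 0"
      \<comment> \<open>The integral bound is not strict; halving \<open>e\<close> makes the final
        one strict.\<close>
      then obtain d where d: "d > 0" "\<And>x y. dist x y < d \<Longrightarrow> dist (G x) (G y) < (e/2) / (W + 1)"
        using Ucont[of "e/2"] by auto
      show "\<exists>d>0. \<forall>x'\<in>UNIV. dist x' x < d \<longrightarrow> dist (\<integral>y. w y *\<^sub>R G (x' + g y) \<partial>M) (\<integral>y. w y *\<^sub>R G (x + g y) \<partial>M) < e"
      proof (intro exI[of _ d] conjI ballI impI d)
        fix x' assume x': "dist x' x < d"
        have r: "norm (G (x' + g y) - G (x + g y)) \<le> (e/2) / (W + 1)" for y
          using d(2)[of "x' + g y" "x + g y"] x' by (auto simp: dist_norm)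
        have "norm ((\<integral>y. w y *\<^sub>R G (x' + g y) \<partial>M) - (\<integral>y. w y *\<^sub>R G (x + g y) \<partial>M))
          = norm (\<integral>y. w y *\<^sub>R (G (x' + g y) - G (x + g y)) \<partial>M)"
          by (simp add: I scaleR_diff_right)
        also have "\<dots> \<le> W * ((e/2) / (W + 1))"
          by (rule norm_integral_weighted_le[OF w _ r, folded W_def]) simp
        also have "\<dots> \<le> e/2" using We[of "e/2"] \<open>e > 0\<close> by simp
        finally show "dist (\<integral>y. w y *\<^sub>R G (x' + g y) \<partial>M) (\<integral>y. w y *\<^sub>R G (x + g y) \<partial>M) < e"
          using \<open>e > 0\<close> by (simp add: dist_norm)
      qed
    qed
  qed
qed

section \<open>Products, multiples and compositions of C1 functions\<close>

lemma C1_grad_mult: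
  assumes "C1_grad a A" "C1_grad b B"
  shows "C1_grad (\<lambda>x. a x * b x) (\<lambda>x. a x *\<^sub>R B x + b x *\<^sub>R A x)"
  unfolding C1_grad_def
proof (intro conjI allI)
  fix x
  show "((\<lambda>x. a x * b x) has_derivative (\<lambda>u. (a x *\<^sub>R B x + b x *\<^sub>R A x) \<bullet> u)) (at x)"
    by (rule has_derivative_eq_rhs[OF has_derivative_mult[OF assms[THEN C1_grad_derivative]]])
       (auto simp: inner_add_left algebra_simps)
qed (intro continuous_intros assms[THEN C1_grad_continuous] assms[THEN C1_grad_continuous_grad])

lemma C1_grad_cmult:
  assumes "C1_grad a A"
  shows "C1_grad (\<lambda>x. c * a x) (\<lambda>x. c *\<^sub>R A x)"
proof -
  have "C1_grad (\<lambda>x. c) (\<lambda>_. 0)" by (simp add: C1_grad_def)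
  from C1_grad_mult[OF this assms] show ?thesis by simp
qed

lemma C1_grad_compose:
  assumes T: "\<And>s. (T has_real_derivative T' s) (at s)" "continuous_on UNIV T'" and a: "C1_grad a A"
  shows "C1_grad (\<lambda>x. T (a x)) (\<lambda>x. T' (a x) *\<^sub>R A x)"
  unfolding C1_grad_def
proof (intro conjI allI)
  fix x
  show "((\<lambda>x. T (a x)) has_derivative (\<lambda>u. (T' (a x) *\<^sub>R A x) \<bullet> u)) (at x)"
    using has_derivative_compose[OF C1_grad_derivative[OF a] T(1)[unfolded has_field_derivative_def]]
    by (simp add: mult.commute)
  show "continuous_on UNIV (\<lambda>x. T' (a x) *\<^sub>R A x)"
    by (intro continuous_intros C1_grad_continuous_grad[OF a] continuous_on_compose2[OF T(2)] C1_grad_continuous[OF a]) auto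
qed

section \<open>Translation invariance and integrals of gradients\<close>

lemma lborel_integral_shift:
  fixes f :: "'a::euclidean_space \<Rightarrow> 'b::{banach, second_countable_topology}"
  assumes [measurable]: "f \<in> borel_measurable borel"
  shows "(\<integral>x. f (c + x) \<partial>lborel) = (\<integral>x. f x \<partial>lborel)"
    and "integrable lborel (\<lambda>x. f (c + x)) \<longleftrightarrow> integrable lborel f"
proof -
  have "(\<integral>x. f x \<partial>distr lborel borel ((+) c)) = (\<integral>x. f (c + x) \<partial>lborel)"
    by (rule integral_distr) auto
  then show "(\<integral>x. f (c + x) \<partial>lborel) = (\<integral>x. f x \<partial>lborel)" by (simp add: lborel_distr_plus)
  have "integrable (distr lborel borel ((+) c)) f \<longleftrightarrow> integrable lborel (\<lambda>x. f (c + x))"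
    by (rule integrable_distr_eq) auto
  then show "integrable lborel (\<lambda>x. f (c + x)) \<longleftrightarrow> integrable lborel f" by (simp add: lborel_distr_plus)
qed

lemma integrable_continuous_compact_support:
  fixes f :: "'a::euclidean_space \<Rightarrow> 'b::{banach, second_countable_topology}"
  assumes "continuous_on UNIV f" "compact K" "\<And>x. x \<notin> K \<Longrightarrow> f x = 0"
  shows "integrable lborel f"
proof -
  have "(\<lambda>x. indicator K x *\<^sub>R f x) = f" using assms(3) by (auto simp: indicator_def)
  with borel_integrable_compact[OF assms(2) continuous_on_subset[OF assms(1)]] show ?thesis by simp
qed

text \<open>Averaging \<open>k\<close> over a large set is locally constant by translation invariance, and its derivative is the
  integral of the gradient.\<close>

lemma integral_gradient_eq_0:
  fixes k :: "'a::euclidean_space \<Rightarrow> real"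
  assumes k: "C1_grad k G" and K: "compact K" "\<And>x. x \<notin> K \<Longrightarrow> k x = 0"
  shows "(\<integral>x. G x \<partial>lborel) = 0"
proof -
  \<comment> \<open>With a margin of 1, the support of \<open>y \<mapsto> k (x + y)\<close> stays
    inside \<open>S\<close> for all \<open>x\<close> in the unit ball, so the average over
    \<open>S\<close> is the full integral there.\<close>
  define S where "S = (\<Union>x\<in>K. cball x 1)"
  have S: "compact S" unfolding S_def by (rule compact_minkowski_sum_cball[OF K(1)])
  have [measurable]: "S \<in> sets borel" "k \<in> borel_measurable borel"
    using S k by (auto intro!: borel_measurable_continuous_onI C1_gradD borel_compact)
  have G0: "x \<notin> K \<Longrightarrow> G x = 0" for x
    using C1_grad_zero_outside[OF k compact_imp_closed[OF K(1)] K(2)] by blast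
  have KS: "K \<subseteq> S" unfolding S_def by force
  have w: "integrable lborel (indicator S :: 'a \<Rightarrow> real)"
    using emeasure_compact_finite[OF S] by simp
  have C1: "C1_grad (\<lambda>x. \<integral>y. indicator S y * k (x + y) \<partial>lborel) (\<lambda>x. \<integral>y. indicator S y *\<^sub>R G (x + y) \<partial>lborel)"
    by (rule C1_grad_average[OF k K w]) auto
  have const: "(\<integral>y. indicator S y * k (x + y) \<partial>lborel) = (\<integral>y. k y \<partial>lborel)" if "x \<in> ball 0 1" for x
  proof -
    have "y \<in> S" if "k (x + y) \<noteq> 0" for y
      using K(2)[of "x + y"] \<open>x \<in> ball 0 1\<close> that unfolding S_def by (auto simp: dist_norm intro!: bexI[of _ "x + y"])
    then have "(\<lambda>y. indicator S y * k (x + y)) = (\<lambda>y. k (x + y))"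
      by (force simp: indicator_def)
    then show ?thesis using lborel_integral_shift(1)[of k x] by simp
  qed
  have "((\<lambda>x. \<integral>y. indicator S y * k (x + y) \<partial>lborel) has_derivative (\<lambda>u. 0)) (at 0)"
    by (rule has_derivative_transform_within_open[where f="\<lambda>_. \<integral>y. k y \<partial>lborel" and s="ball 0 1"])
       (auto simp: const)
  from C1_grad_unique_at[OF C1 this]
  have *: "0 = (\<integral>y. indicator S y *\<^sub>R G (0 + y) \<partial>lborel) \<bullet> u" for u by meson
  have "(\<lambda>y. indicator S y *\<^sub>R G (0 + y)) = G" using G0 KS by (force simp: indicator_def)
  with *[of "\<integral>y. G y \<partial>lborel"] show ?thesis by simp
qed

section \<open>Construction of mollifiers\<close>

text \<open>The square of the positive part vanishes on a half-line and is C1, since at 0 its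
  difference quotient is at most \<open>\<bar>h\<bar>\<close>. Composed with
  \<open>1 - (x \<bullet> x) / e\<^sup>2\<close> it gives a bump that is exactly as smooth as
  required.\<close>

lemma max_0_square_has_derivative:
  "((\<lambda>t::real. (max 0 t)\<^sup>2) has_real_derivative 2 * max 0 t) (at t)"
proof (cases t "0 :: real" rule: linorder_cases)
  case less
  have "((\<lambda>t::real. (max 0 t)\<^sup>2) has_real_derivative 0) (at t)"
    by (rule has_field_derivative_transform_within_open[OF DERIV_const[of 0], where S="{..<0}"])
       (use less in \<open>simp_all add: max_def\<close>)
  then show ?thesis using less by simp
next
  case greater
  have "((\<lambda>t::real. t\<^sup>2) has_real_derivative 2 * t) (at t)"
    by (auto intro!: derivative_eq_intros)
  then have "((\<lambda>t::real. (max 0 t)\<^sup>2) has_real_derivative 2 * t) (at t)"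
    by (rule has_field_derivative_transform_within_open[where S="{0<..}"])
       (use greater in \<open>simp_all add: max_def\<close>)
  then show ?thesis using greater by simp
next
  case equal
  have "((\<lambda>h. (max 0 h)\<^sup>2 / h) \<longlongrightarrow> 0) (at (0::real))"
  proof (rule Lim_null_comparison)
    show "\<forall>\<^sub>F h in at 0. norm ((max 0 h)\<^sup>2 / h) \<le> \<bar>h\<bar>" for h :: real
      by (auto simp: power2_eq_square max_def intro!: eventuallyI)
    show "((\<lambda>h::real. \<bar>h\<bar>) \<longlongrightarrow> 0) (at 0)"
      by (intro tendsto_eq_intros) auto
  qed
  then show ?thesis using equal by (simp add: DERIV_def)
qed

text \<open>The gradient is a parameter so that gradients of convolutions can be written down.
  Evenness of the kernel and oddness of its gradient allow a convolution to be moved from the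
  function to the test field.\<close>

definition mollifier :: "real \<Rightarrow> ('a::euclidean_space \<Rightarrow> real) \<Rightarrow> ('a \<Rightarrow> 'a) \<Rightarrow> bool"
  where "mollifier e \<rho> G \<longleftrightarrow> C1_grad \<rho> G \<and> (\<forall>x. 0 \<le> \<rho> x) \<and> (\<forall>x. x \<notin> cball 0 e \<longrightarrow> \<rho> x = 0) \<and>
    (\<integral>x. \<rho> x \<partial>lborel) = 1 \<and> (\<forall>x. \<rho> (- x) = \<rho> x) \<and> (\<forall>x. G (- x) = - G x)"

lemma mollifier_exists:
  assumes "0 < e"
  obtains \<rho> :: "'a::euclidean_space \<Rightarrow> real" and G where "mollifier e \<rho> G"
proof -
  define \<rho> :: "'a \<Rightarrow> real" where "\<rho> x = (max 0 (1 - (x \<bullet> x) / e\<^sup>2))\<^sup>2" for x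
  define G where "G x = (2 * max 0 (1 - (x \<bullet> x) / e\<^sup>2)) *\<^sub>R (- (2 / e\<^sup>2) *\<^sub>R x)" for x :: 'a
  have "C1_grad (\<lambda>x::'a. 1 - (x \<bullet> x) / e\<^sup>2) (\<lambda>x. - (2 / e\<^sup>2) *\<^sub>R x)"
    unfolding C1_grad_def using assms
    by (auto intro!: derivative_eq_intros continuous_intros ext
        simp: inner_commute field_simps power2_eq_square power4_eq_xxxx)
  moreover have "continuous_on UNIV (\<lambda>s::real. 2 * max 0 s)" by (intro continuous_intros)
  ultimately have C: "C1_grad \<rho> G"
    unfolding \<rho>_def[abs_def] G_def[abs_def] by (intro C1_grad_compose[OF max_0_square_has_derivative])
  have nn: "0 \<le> \<rho> x" for x by (simp add: \<rho>_def)
  have 0: "\<rho> x = 0" if "x \<notin> cball 0 e" for x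
  proof -
    have "e\<^sup>2 \<le> x \<bullet> x" using that assms by (simp add: power2_norm_eq_inner[symmetric])
    then have "1 \<le> (x \<bullet> x) / e\<^sup>2" using assms by simp
    then show ?thesis by (simp add: \<rho>_def)
  qed
  have int: "integrable lborel \<rho>"
    by (rule integrable_continuous_compact_support[OF C1_grad_continuous[OF C] compact_cball 0])
  \<comment> \<open>A zero integral would make \<rho> vanish almost everywhere, hence everywhere
    because its zero set is closed; but its value at 0 is 1.\<close>
  have "(\<integral>x. \<rho> x \<partial>lborel) \<noteq> 0"
  proof
    assume "(\<integral>x. \<rho> x \<partial>lborel) = 0"
    then have "AE x in lborel. \<rho> x = 0"
      using integral_nonneg_eq_0_iff_AE[OF int] nn by simp
    then have "AE x in lebesgue. x \<in> {x. \<rho> x = 0}" by (auto intro: AE_completion)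
    moreover have "closed {x. \<rho> x = 0}"
      by (intro closed_Collect_eq C1_grad_continuous[OF C] continuous_intros)
    ultimately have "(0::'a) \<in> {x. \<rho> x = 0}" by (rule mem_closed_if_AE_lebesgue[rotated])
    then show False by (simp add: \<rho>_def)
  qed
  moreover have "(\<integral>x. \<rho> x \<partial>lborel) \<ge> 0" using nn by simp
  ultimately have c: "(\<integral>x. \<rho> x \<partial>lborel) > 0" by simp
  show thesis
  proof (rule that[of "\<lambda>x. (1 / (\<integral>x. \<rho> x \<partial>lborel)) * \<rho> x" "\<lambda>x. (1 / (\<integral>x. \<rho> x \<partial>lborel)) *\<^sub>R G x"],
      unfold mollifier_def, intro conjI allI impI)
    show "C1_grad (\<lambda>x. (1 / (\<integral>x. \<rho> x \<partial>lborel)) * \<rho> x) (\<lambda>x. (1 / (\<integral>x. \<rho> x \<partial>lborel)) *\<^sub>R G x)"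
      by (rule C1_grad_cmult[OF C])
    show "1 / (\<integral>x. \<rho> x \<partial>lborel) * \<rho> (- x) = 1 / (\<integral>x. \<rho> x \<partial>lborel) * \<rho> x" for x
      by (simp add: \<rho>_def)
    show "(1 / (\<integral>x. \<rho> x \<partial>lborel)) *\<^sub>R G (- x) = - ((1 / (\<integral>x. \<rho> x \<partial>lborel)) *\<^sub>R G x)" for x
      by (simp add: G_def)
  qed (use nn 0 c in auto)
qed

section \<open>Test fields and their components\<close>

text \<open>The derivative in \<open>C1_compactly_supported\<close> is operator valued. Assembling
  it from component gradients allows all test fields to be built from scalar averages.\<close>

lemma C1_compactly_supportedI:
  fixes \<phi> :: "'a::euclidean_space \<Rightarrow> 'a"
  assumes C: "\<And>b. b \<in> Basis \<Longrightarrow> C1_grad (\<lambda>x. \<phi> x \<bullet> b) (G b)"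
    and K: "compact K" "K \<subseteq> \<Omega>" "\<And>x. x \<notin> K \<Longrightarrow> \<phi> x = 0"
  shows "\<phi> \<in> C1_compactly_supported \<Omega>"
    and "divergence \<phi> x = (\<Sum>b\<in>Basis. G b x \<bullet> b)"
proof -
  define D where "D x u = (\<Sum>b\<in>Basis. (G b x \<bullet> u) *\<^sub>R b)" for x u
  have D: "(\<phi> has_derivative D x) (at x)" for x
  proof -
    have "((\<lambda>x. \<phi> x \<bullet> b) has_derivative (\<lambda>u. D x u \<bullet> b)) (at x)" if "b \<in> Basis" for b
      using C1_grad_derivative[OF C[OF that]] that
      by (simp add: D_def inner_sum_left inner_Basis if_distrib sum.delta cong: if_cong)
    then show ?thesis using has_derivative_componentwise_within[of \<phi> "D x" x UNIV] by auto
  qed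
  then have bl: "bounded_linear (D x)" for x by (rule has_derivative_bounded_linear)
  have "continuous_on UNIV (\<lambda>x. Blinfun (D x))"
    by (rule continuous_on_blinfun_componentwise)
       (auto simp: bounded_linear_Blinfun_apply[OF bl] D_def intro!: continuous_intros C1_grad_continuous_grad[OF C])
  moreover have "{x. \<phi> x \<noteq> 0} \<subseteq> K" using K by auto
  then have "closure {x. \<phi> x \<noteq> 0} \<subseteq> K" using K(1) by (simp add: closure_minimal compact_imp_closed)
  ultimately show "\<phi> \<in> C1_compactly_supported \<Omega>"
    unfolding C1_compactly_supported_def using K D bounded_subset[OF compact_imp_bounded[OF K(1)]]
    by (auto intro!: exI[of _ "\<lambda>x. Blinfun (D x)"] simp: bounded_linear_Blinfun_apply[OF bl] compact_eq_bounded_closed)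
  have "frechet_derivative \<phi> (at x) = D x" using frechet_derivative_at[OF D] by metis
  then show "divergence \<phi> x = (\<Sum>b\<in>Basis. G b x \<bullet> b)"
    unfolding divergence_def D_def
    by (auto intro!: sum.cong simp: inner_sum_left inner_Basis if_distrib sum.delta cong: if_cong)
qed

text \<open>\<open>K\<close> is the closed support, so its complement is open and the component
  gradients, hence the divergence, vanish there as well.\<close>

lemma C1_compactly_supportedE:
  fixes \<phi> :: "'a::euclidean_space \<Rightarrow> 'a"
  assumes "\<phi> \<in> C1_compactly_supported \<Omega>"
  shows "\<exists>G K. (\<forall>b\<in>Basis. C1_grad (\<lambda>x. \<phi> x \<bullet> b) (G b)) \<and>
    compact K \<and> K \<subseteq> \<Omega> \<and> (\<forall>x. x \<notin> K \<longrightarrow> \<phi> x = 0) \<and>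
    (\<forall>x. divergence \<phi> x = (\<Sum>b\<in>Basis. G b x \<bullet> b)) \<and>
    continuous_on UNIV (divergence \<phi>) \<and> (\<forall>x. x \<notin> K \<longrightarrow> divergence \<phi> x = 0)"
proof -
  obtain \<phi>' where D: "\<And>x. (\<phi> has_derivative blinfun_apply (\<phi>' x)) (at x)" and cont: "continuous_on UNIV \<phi>'"
    and K: "compact (closure {x. \<phi> x \<noteq> 0})" "closure {x. \<phi> x \<noteq> 0} \<subseteq> \<Omega>"
    using assms unfolding C1_compactly_supported_def by blast
  define G where "G b x = (\<Sum>j\<in>Basis. (\<phi>' x j \<bullet> b) *\<^sub>R j)" for b x
  have G: "C1_grad (\<lambda>x. \<phi> x \<bullet> b) (G b)" for b
    unfolding C1_grad_def
  proof (intro conjI allI)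
    fix x
    have "(\<lambda>u. G b x \<bullet> u) = (\<lambda>u. \<phi>' x u \<bullet> b)"
    proof
      fix u
      have "\<phi>' x u = \<phi>' x (\<Sum>j\<in>Basis. (u \<bullet> j) *\<^sub>R j)" by (simp add: euclidean_representation)
      also have "\<dots> = (\<Sum>j\<in>Basis. (u \<bullet> j) *\<^sub>R \<phi>' x j)" by (simp add: blinfun.sum_right blinfun.scaleR_right)
      finally show "G b x \<bullet> u = \<phi>' x u \<bullet> b"
        by (simp add: G_def inner_sum_left inner_commute[of u] mult.commute)
    qed
    then show "((\<lambda>x. \<phi> x \<bullet> b) has_derivative (\<lambda>u. G b x \<bullet> u)) (at x)"
      using D by (auto intro!: derivative_eq_intros)
    show "continuous_on UNIV (G b)"
      unfolding G_def[abs_def] by (intro continuous_intros cont)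
  qed
  have G0: "G b x = 0" if "x \<notin> closure {x. \<phi> x \<noteq> 0}" for b x
    by (rule C1_grad_zero_outside[OF G closed_closure _ that])
       (metis (mono_tags) closure_subset inner_zero_left mem_Collect_eq subsetD)
  have div: "divergence \<phi> x = (\<Sum>b\<in>Basis. G b x \<bullet> b)" for x
    unfolding divergence_def frechet_derivative_at[OF D, symmetric] G_def
    by (auto intro!: sum.cong simp: inner_sum_left inner_Basis if_distrib sum.delta cong: if_cong)
  show ?thesis
  proof (intro exI[of _ G] exI[of _ "closure {x. \<phi> x \<noteq> 0}"] conjI ballI allI impI G K div)
    show "\<phi> x = 0" if "x \<notin> closure {x. \<phi> x \<noteq> 0}" for x
      using closure_subset[of "{x. \<phi> x \<noteq> 0}"] that by blast
    show "continuous_on UNIV (divergence \<phi>)"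
      unfolding div[abs_def] by (intro continuous_intros C1_grad_continuous_grad[OF G])
    show "divergence \<phi> x = 0" if "x \<notin> closure {x. \<phi> x \<noteq> 0}" for x
      unfolding div using G0[OF that] by simp
  qed
qed

section \<open>Mollification\<close>

lemma mollifierD:
  assumes "mollifier e \<rho> G"
  shows mollifier_C1: "C1_grad \<rho> G"
    and mollifier_nonneg: "0 \<le> \<rho> x"
    and mollifier_support: "x \<notin> cball 0 e \<Longrightarrow> \<rho> x = 0"
    and mollifier_even: "\<rho> (x - y) = \<rho> (y - x)"
    and mollifier_grad_odd: "G (x - y) = - G (y - x)"
    and mollifier_measurable: "\<rho> \<in> borel_measurable borel" "G \<in> borel_measurable borel"
    and mollifier_integrable: "integrable lborel (\<lambda>y. \<rho> (x - y))" "integrable lborel (\<lambda>y. \<rho> (y - x))"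
    and mollifier_integral: "(\<integral>y. \<rho> (x - y) \<partial>lborel) = 1" "(\<integral>y. \<rho> (y - x) \<partial>lborel) = 1"
proof -
  show C: "C1_grad \<rho> G" and "0 \<le> \<rho> x" and s: "x \<notin> cball 0 e \<Longrightarrow> \<rho> x = 0" for x
    using assms by (auto simp: mollifier_def)
  show even: "\<rho> (x - y) = \<rho> (y - x)" for x y
    using assms unfolding mollifier_def by (metis minus_diff_eq)
  show "G (x - y) = - G (y - x)"
    using assms unfolding mollifier_def by (metis minus_diff_eq)
  show m[measurable]: "\<rho> \<in> borel_measurable borel" "G \<in> borel_measurable borel"
    using C by (auto intro!: borel_measurable_continuous_onI C1_gradD)
  have "integrable lborel \<rho>"
    by (rule integrable_continuous_compact_support[OF C1_grad_continuous[OF C] compact_cball s])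
  then show "integrable lborel (\<lambda>y. \<rho> (y - x))"
    using lborel_integral_shift(2)[OF m(1), of "- x"] by simp
  then show "integrable lborel (\<lambda>y. \<rho> (x - y))" by (subst even)
  show "(\<integral>y. \<rho> (y - x) \<partial>lborel) = 1"
    using lborel_integral_shift(1)[OF m(1), of "- x"] assms by (simp add: mollifier_def)
  then show "(\<integral>y. \<rho> (x - y) \<partial>lborel) = 1" by (subst even)
qed

lemma mollify_C1:
  assumes m: "mollifier e \<rho> G" and w: "integrable lborel w"
  shows "C1_grad (\<lambda>x. \<integral>y. w y * \<rho> (x - y) \<partial>lborel) (\<lambda>x. \<integral>y. w y *\<^sub>R G (x - y) \<partial>lborel)"
    and "integrable lborel (\<lambda>y. w y * \<rho> (x - y))" and "integrable lborel (\<lambda>y. w y *\<^sub>R G (x - y))"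
  using C1_grad_average[OF mollifier_C1[OF m] compact_cball[of 0 e] mollifier_support[OF m] w, where g="\<lambda>y. - y"] by auto

text \<open>The kernel is a probability density on a ball of radius \<open>e\<close>, so only values
  of \<open>w\<close> on that ball count. The local form yields both a sup bound and, applied to
  \<open>w y - w x\<close>, an error bound from the modulus of continuity.\<close>

lemma mollify_bound:
  assumes m: "mollifier e \<rho> G" and w: "w \<in> borel_measurable borel"
    and B: "\<And>y. dist y x \<le> e \<Longrightarrow> \<bar>w y\<bar> \<le> B" and "B \<ge> 0"
  shows "\<bar>\<integral>y. w y * \<rho> (x - y) \<partial>lborel\<bar> \<le> B"
proof -
  note [measurable] = w mollifier_measurable[OF m]
  \<comment> \<open>Cutting \<open>w\<close> off outside the ball leaves the integrand unchanged and
    makes the bound global. The kernel then takes the role of the integrable weight.\<close>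
  let ?w = "\<lambda>y. if dist y x \<le> e then w y else 0"
  have "(\<lambda>y. w y * \<rho> (x - y)) = (\<lambda>y. \<rho> (x - y) *\<^sub>R ?w y)"
    using mollifier_support[OF m, of "x - _"] by (auto simp: dist_norm norm_minus_commute)
  moreover have "norm (\<integral>y. \<rho> (x - y) *\<^sub>R ?w y \<partial>lborel) \<le> (\<integral>y. \<bar>\<rho> (x - y)\<bar> \<partial>lborel) * B"
    using B \<open>B \<ge> 0\<close> by (intro norm_integral_weighted_le mollifier_integrable[OF m]) auto
  ultimately show ?thesis
    by (simp add: mollifier_nonneg[OF m] mollifier_integral[OF m])
qed

lemma mollify_minus:
  assumes m: "mollifier e \<rho> G" and w: "integrable lborel w"
  shows "(\<integral>y. w y * \<rho> (x - y) \<partial>lborel) - w x = (\<integral>y. (w y - w x) * \<rho> (x - y) \<partial>lborel)"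
proof -
  have "(\<integral>y. (w y - w x) * \<rho> (x - y) \<partial>lborel)
      = (\<integral>y. w y * \<rho> (x - y) \<partial>lborel) - (\<integral>y. w x * \<rho> (x - y) \<partial>lborel)"
    unfolding left_diff_distrib
    by (intro Bochner_Integration.integral_diff mollify_C1[OF m w] integrable_mult_right mollifier_integrable[OF m])
  then show ?thesis by (simp add: mollifier_integral[OF m])
qed

lemma mollify_support:
  assumes m: "mollifier e \<rho> G" and w: "\<And>y. y \<notin> K \<Longrightarrow> w y = 0" and x: "x \<notin> (\<Union>y\<in>K. cball y e)"
  shows "(\<integral>y. w y * \<rho> (x - y) \<partial>lborel) = 0"
proof -
  have "w y * \<rho> (x - y) = 0" for y
    using w[of y] x mollifier_support[OF m, of "x - y"]
    by (cases "y \<in> K") (auto simp: dist_norm norm_minus_commute)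
  then have "(\<lambda>y. w y * \<rho> (x - y)) = (\<lambda>_. 0)" by (rule ext)
  then show ?thesis by simp
qed

section \<open>Approximation by compactly supported C1 functions\<close>

lemma C1_approximation_continuous:
  fixes p :: "'a::euclidean_space \<Rightarrow> real"
  assumes p: "continuous_on UNIV p" and K: "compact K" "\<And>x. x \<notin> K \<Longrightarrow> p x = 0"
    and B: "\<And>x. \<bar>p x\<bar> \<le> B" and "0 < d" "0 < c"
  obtains h H where "C1_grad h H" "\<And>x. \<bar>h x\<bar> \<le> B" "\<And>x. \<bar>h x - p x\<bar> \<le> c"
    "\<And>x. x \<notin> (\<Union>y\<in>K. cball y d) \<Longrightarrow> h x = 0"
proof -
  obtain e where e: "e > 0" "\<And>x y. dist x y < e \<Longrightarrow> dist (p x) (p y) < c"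
    using uniformly_continuous_compact_support[OF p K \<open>0 < c\<close>] by metis
  \<comment> \<open>Strictly below the continuity scale \<open>e\<close>, and at most
    \<open>d\<close> so that the support grows by no more than \<open>d\<close>.\<close>
  define e' where "e' = min (e/2) d"
  have e': "0 < e'" "e' < e" "e' \<le> d" using e \<open>0 < d\<close> by (auto simp: e'_def)
  obtain \<rho> G where m: "mollifier e' \<rho> (G :: 'a \<Rightarrow> 'a)"
    using mollifier_exists[OF e'(1)] .
  have pm: "p \<in> borel_measurable borel" by (intro borel_measurable_continuous_onI p)
  have pi: "integrable lborel p" by (rule integrable_continuous_compact_support[OF p K])
  show thesis
  proof (rule that[OF mollify_C1(1)[OF m pi]])
    fix x
    show "\<bar>\<integral>y. p y * \<rho> (x - y) \<partial>lborel\<bar> \<le> B"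
      using B order_trans[OF abs_ge_zero B] by (intro mollify_bound[OF m pm])
    show "\<bar>(\<integral>y. p y * \<rho> (x - y) \<partial>lborel) - p x\<bar> \<le> c"
      unfolding mollify_minus[OF m pi]
    proof (rule mollify_bound[OF m])
      show "\<bar>p y - p x\<bar> \<le> c" if "dist y x \<le> e'" for y
        using e(2)[of y x] that e' by (auto simp: dist_real_def)
    qed (use pm \<open>0 < c\<close> in auto)
  next
    fix x assume "x \<notin> (\<Union>y\<in>K. cball y d)"
    then show "(\<integral>y. p y * \<rho> (x - y) \<partial>lborel) = 0"
      using e'(3) by (intro mollify_support[OF m K(2)]) auto
  qed
qed

lemma UN_cball_UN_cball_subset:
  "(\<Union>y\<in>(\<Union>z\<in>K. cball z a). cball y b) \<subseteq> (\<Union>z\<in>K. cball z (a + b))"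
proof clarsimp
  fix x y z assume "z \<in> K" "dist z y \<le> a" "dist y x \<le> b"
  then show "\<exists>z\<in>K. dist z x \<le> a + b"
    by (intro bexI[of _ z] order_trans[OF dist_triangle[of z x y]] add_mono)
qed

text \<open>A measurable function is an almost everywhere limit of continuous ones. Clamping these
  to [-1, 1], cutting them off near \<open>K\<close> and mollifying with error
  \<open>1 / real (Suc n)\<close> preserves the limit. The purpose is to approximate a sign function
  by admissible test functions.\<close>

lemma C1_approximation_measurable:
  fixes \<psi> :: "'a::euclidean_space \<Rightarrow> real"
  assumes \<psi>: "\<psi> \<in> borel_measurable borel" "\<And>x. \<bar>\<psi> x\<bar> \<le> 1" and K: "compact K" "\<And>x. x \<notin> K \<Longrightarrow> \<psi> x = 0"
    and "0 < d"
  shows "\<exists>h H. (\<forall>n::nat. C1_grad (h n) (H n)) \<and> (\<forall>n x. \<bar>h n x\<bar> \<le> 1) \<and>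
    (\<forall>n x. x \<notin> (\<Union>y\<in>K. cball y d) \<longrightarrow> h n x = 0) \<and>
    (AE x in lborel. (\<lambda>n. h n x) \<longlonglongrightarrow> \<psi> x)"
proof (cases "K = {}")
  \<comment> \<open>\<open>infdist\<close> to the empty set is 0 by convention, so the cutoff used
    in the other case would not vanish anywhere.\<close>
  case True
  then have "\<psi> = (\<lambda>_. 0)" using K by auto
  then show ?thesis by (intro exI[of _ "\<lambda>_ _. 0"]) (auto simp: C1_grad_def)
next
  case False
  have "\<psi> \<in> borel_measurable lebesgue" using \<psi>(1) by (auto intro: measurable_completion)
  then have "\<psi> measurable_on UNIV" by (intro lebesgue_measurable_imp_measurable_on) auto
  then obtain N g where N: "negligible N" and g: "\<And>n::nat. continuous_on UNIV (g n)"
      "\<And>x. x \<notin> N \<Longrightarrow> (\<lambda>n. g n x) \<longlonglongrightarrow> \<psi> x"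
    unfolding measurable_on_def by auto
  \<comment> \<open>A continuous cutoff equal to 1 on \<open>K\<close> and to 0 at distance
    \<open>d / 2\<close> and beyond; the other half of \<open>d\<close> is left for the
    mollification.\<close>
  define \<eta> where "\<eta> x = max 0 (1 - 2 / d * infdist x K)" for x
  define p where "p n x = \<eta> x * max (-1) (min 1 (g n x))" for n x
  define K' where "K' = (\<Union>y\<in>K. cball y (d/2))"
  have K': "compact K'" unfolding K'_def by (rule compact_minkowski_sum_cball[OF K(1)])
  have \<eta>: "0 \<le> \<eta> x" "\<eta> x \<le> 1" for x
    using infdist_nonneg[of x K] \<open>0 < d\<close> by (auto simp: \<eta>_def)
  have \<eta>0: "\<eta> x = 0" if "x \<notin> K'" for x
  proof -
    obtain y where y: "y \<in> K" "infdist x K = dist x y"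
      using infdist_attains_inf[OF compact_imp_closed[OF K(1)] False] by metis
    with that have "d/2 < dist x y" by (force simp: K'_def dist_commute)
    then show ?thesis using y \<open>0 < d\<close> by (simp add: \<eta>_def field_simps)
  qed
  have p: "continuous_on UNIV (p n)" for n
    unfolding p_def[abs_def] \<eta>_def[abs_def] by (intro continuous_intros g)
  have p1: "\<bar>p n x\<bar> \<le> 1" for n x
    using mult_mono[OF \<eta>(2)[of x], of "\<bar>max (-1) (min 1 (g n x))\<bar>" 1] \<eta>(1)[of x]
    by (auto simp: p_def abs_mult)
  have "\<exists>h H. C1_grad h H \<and> (\<forall>x. \<bar>h x\<bar> \<le> 1) \<and> (\<forall>x. \<bar>h x - p n x\<bar> \<le> 1 / real (Suc n)) \<and>
      (\<forall>x. x \<notin> (\<Union>y\<in>K'. cball y (d/2)) \<longrightarrow> h x = 0)" for n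
    by (rule C1_approximation_continuous[OF p K', of n 1 "d/2" "1 / real (Suc n)"])
       (use \<eta>0 p1 \<open>0 < d\<close> in \<open>auto simp: p_def\<close>)
  then obtain h H where h: "\<And>n. C1_grad (h n) (H n)" "\<And>n x. \<bar>h n x\<bar> \<le> 1"
    "\<And>n x. \<bar>h n x - p n x\<bar> \<le> 1 / real (Suc n)" "\<And>n x. x \<notin> (\<Union>y\<in>K'. cball y (d/2)) \<Longrightarrow> h n x = 0"
    by metis
  show ?thesis
  proof (intro exI[of _ h] exI[of _ H] conjI allI impI h(1,2))
    fix n x assume "x \<notin> (\<Union>y\<in>K. cball y d)"
    then have "x \<notin> (\<Union>y\<in>K'. cball y (d/2))"
      using UN_cball_UN_cball_subset[where K=K and a="d/2" and b="d/2"] unfolding K'_def by force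
    then show "h n x = 0" by (rule h(4))
  next
    have "(\<lambda>n. h n x) \<longlonglongrightarrow> \<psi> x" if "x \<notin> N" for x
    proof -
      have "(\<lambda>n. p n x) \<longlonglongrightarrow> \<eta> x * max (-1) (min 1 (\<psi> x))"
        unfolding p_def by (intro tendsto_intros g(2)[OF that])
      also have "\<eta> x * max (-1) (min 1 (\<psi> x)) = \<psi> x"
        using \<psi>(2)[of x] K(2)[of x] by (cases "x \<in> K") (auto simp: \<eta>_def)
      finally have "(\<lambda>n. p n x) \<longlonglongrightarrow> \<psi> x" .
      moreover have "(\<lambda>n. h n x - p n x) \<longlonglongrightarrow> 0"
        by (rule Lim_null_comparison[OF _ LIMSEQ_Suc[OF lim_1_over_n]]) (use h(3) in auto)
      ultimately have "(\<lambda>n. p n x + (h n x - p n x)) \<longlonglongrightarrow> \<psi> x + 0" by (intro tendsto_add)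
      then show ?thesis by simp
    qed
    moreover have "AE x in lebesgue. x \<notin> N"
      using N by (simp add: negligible_iff_null_sets AE_not_in)
    ultimately show "AE x in lborel. (\<lambda>n. h n x) \<longlonglongrightarrow> \<psi> x"
      by (auto simp: AE_completion_iff elim: eventually_mono)
  qed
qed

text \<open>Bounds \<^const>\<open>TV\<close> for Borel functions and \<^const>\<open>lborel\<close>, so that Fubini applies to convolutions, which need not be
  product measurable for functions that are only Lebesgue measurable.\<close>

definition variation_le :: "'a::euclidean_space set \<Rightarrow> ('a \<Rightarrow> real) \<Rightarrow> real \<Rightarrow> bool"
  where "variation_le \<Omega> u C \<longleftrightarrow> (\<forall>\<phi>\<in>C1_compactly_supported \<Omega>. (\<forall>x. norm (\<phi> x) \<le> 1) \<longrightarrow>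
    (\<integral>x. u x * divergence \<phi> x \<partial>lborel) \<le> C)"

lemma variation_leD:
  "variation_le \<Omega> u C \<Longrightarrow> \<phi> \<in> C1_compactly_supported \<Omega> \<Longrightarrow> (\<And>x. norm (\<phi> x) \<le> 1) \<Longrightarrow>
    (\<integral>x. u x * divergence \<phi> x \<partial>lborel) \<le> C"
  by (simp add: variation_le_def)

text \<open>The test field is \<open>\<phi> x = - (\<integral>t\<in>{0..1}. \<psi> (x - t h)) h / |h|\<close>, whose divergence is \<open>(\<psi> (x - h) - \<psi> x) / |h|\<close>.\<close>

lemma variation_le_translation_test:
  fixes \<psi> :: "'a::euclidean_space \<Rightarrow> real"
  assumes u: "variation_le \<Omega> u C" and \<psi>: "C1_grad \<psi> G" "\<And>x. \<bar>\<psi> x\<bar> \<le> 1"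
    and K: "compact K" "\<And>x. x \<notin> K \<Longrightarrow> \<psi> x = 0" "(\<Union>x\<in>K. cball x (norm h)) \<subseteq> \<Omega>"
  shows "(\<integral>x. u x * (\<psi> (x - h) - \<psi> x) \<partial>lborel) \<le> norm h * C"
proof (cases "h = 0")
  case True then show ?thesis by simp
next
  case h: False
  define w :: "real \<Rightarrow> real" where "w = indicator {0..1}"
  define p where "p x = (\<integral>t. w t * \<psi> (x + - (t *\<^sub>R h)) \<partial>lborel)" for x
  define P where "P x = (\<integral>t. w t *\<^sub>R G (x + - (t *\<^sub>R h)) \<partial>lborel)" for x
  have w: "integrable lborel w" unfolding w_def by simp
  have p: "C1_grad p P" unfolding p_def[abs_def] P_def[abs_def]
    by (rule C1_grad_average[OF \<psi>(1) K(1,2) w]) auto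
  have Pi: "integrable lborel (\<lambda>t. w t *\<^sub>R G (x + - (t *\<^sub>R h)))" for x
    by (rule C1_grad_average[OF \<psi>(1) K(1,2) w]) auto
  define \<phi> where "\<phi> x = (- p x / norm h) *\<^sub>R h" for x
  have comp: "C1_grad (\<lambda>x. \<phi> x \<bullet> b) (\<lambda>x. (- (h \<bullet> b) / norm h) *\<^sub>R P x)" for b
    using C1_grad_cmult[OF p, of "- (h \<bullet> b) / norm h"] by (simp add: \<phi>_def[abs_def] mult.commute)
  let ?S = "\<Union>x\<in>K. cball x (norm h)"
  have supp: "\<phi> x = 0" if "x \<notin> ?S" for x
  proof -
    have "w t * \<psi> (x + - (t *\<^sub>R h)) = 0" for t
    proof (rule ccontr)
      assume "w t * \<psi> (x + - (t *\<^sub>R h)) \<noteq> 0"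
      then have "x + - (t *\<^sub>R h) \<in> K" "0 \<le> t" "t \<le> 1" using K(2) by (auto simp: w_def indicator_def split: if_splits)
      moreover have "dist (x + - (t *\<^sub>R h)) x \<le> norm h"
        using \<open>0 \<le> t\<close> \<open>t \<le> 1\<close> by (simp add: dist_norm mult_left_le_one_le)
      ultimately show False using that by (metis UN_I mem_cball)
    qed
    then have "(\<lambda>t. w t * \<psi> (x + - (t *\<^sub>R h))) = (\<lambda>_. 0)" by (rule ext)
    then have "p x = 0" unfolding p_def by simp
    then show ?thesis by (simp add: \<phi>_def)
  qed
  note I = C1_compactly_supportedI[where \<phi>=\<phi> and G="\<lambda>b x. (- (h \<bullet> b) / norm h) *\<^sub>R P x",
      OF comp compact_minkowski_sum_cball[OF K(1)] K(3) supp]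
  have "\<bar>p x\<bar> \<le> 1" for x
  proof -
    have [measurable]: "\<psi> \<in> borel_measurable borel"
      by (intro borel_measurable_continuous_onI C1_grad_continuous[OF \<psi>(1)])
    have "norm (\<integral>t. w t *\<^sub>R \<psi> (x + - (t *\<^sub>R h)) \<partial>lborel) \<le> (\<integral>t. \<bar>w t\<bar> \<partial>lborel) * 1"
      using \<psi>(2) by (intro norm_integral_weighted_le[OF w]) auto
    then show ?thesis by (simp add: p_def w_def)
  qed
  then have n1: "norm (\<phi> x) \<le> 1" for x using h by (simp add: \<phi>_def)
  have div: "divergence \<phi> x = (\<psi> (x - h) - \<psi> x) / norm h" for x
  proof -
    have "divergence \<phi> x = - (\<Sum>b\<in>Basis. (P x \<bullet> b) * (h \<bullet> b)) / norm h"
      using I(2) by (simp add: sum_negf sum_divide_distrib mult.commute)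
    also have "\<dots> = - (P x \<bullet> h) / norm h" unfolding euclidean_inner[of "P x" h] by (rule refl)
    also have "P x \<bullet> h = (\<integral>t. indicator {0..1} t *\<^sub>R (G (x - t *\<^sub>R h) \<bullet> h) \<partial>lborel)"
      unfolding P_def using Pi[of x] by (subst integral_inner_left[symmetric]) (auto simp: w_def)
    also have "\<dots> = - \<psi> (x - 1 *\<^sub>R h) - (- \<psi> (x - 0 *\<^sub>R h))"
    proof (rule integral_FTC_atLeastAtMost)
      fix t :: real
      have "((\<lambda>t. - \<psi> (x - t *\<^sub>R h)) has_derivative (\<lambda>s. - (G (x - t *\<^sub>R h) \<bullet> (- (s *\<^sub>R h))))) (at t)"
        by (intro has_derivative_minus has_derivative_compose[OF _ C1_grad_derivative[OF \<psi>(1)]])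
           (auto intro!: derivative_eq_intros)
      then show "((\<lambda>t. - \<psi> (x - t *\<^sub>R h)) has_vector_derivative G (x - t *\<^sub>R h) \<bullet> h) (at t within {0..1})"
        by (simp add: has_vector_derivative_def has_derivative_at_withinI)
    next
      show "continuous_on {0..1} (\<lambda>t. G (x - t *\<^sub>R h) \<bullet> h)"
        by (intro continuous_intros continuous_on_compose2[OF C1_grad_continuous_grad[OF \<psi>(1), of UNIV]]) auto
    qed simp
    finally show ?thesis by simp
  qed
  have "(\<integral>x. u x * divergence \<phi> x \<partial>lborel) \<le> C"
    by (rule variation_leD[OF u I(1) n1])
  then have "(\<integral>x. u x * (\<psi> (x - h) - \<psi> x) \<partial>lborel) / norm h \<le> C"
    by (simp add: div)
  then show ?thesis using h by (simp add: field_simps)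
qed

section \<open>Translations of functions of bounded variation\<close>

lemma lborel_nn_integral_shift:
  fixes f :: "'a::euclidean_space \<Rightarrow> ennreal"
  assumes [measurable]: "f \<in> borel_measurable borel"
  shows "(\<integral>\<^sup>+x. f (c + x) \<partial>lborel) = (\<integral>\<^sup>+x. f x \<partial>lborel)"
proof -
  have "(\<integral>\<^sup>+x. f x \<partial>distr lborel borel ((+) c)) = (\<integral>\<^sup>+x. f (c + x) \<partial>lborel)"
    by (rule nn_integral_distr) auto
  then show ?thesis by (simp add: lborel_distr_plus)
qed

lemma integrable_mult_bounded:
  fixes f w :: "'a \<Rightarrow> real"
  assumes "integrable M w" "f \<in> borel_measurable M" "\<And>x. \<bar>f x\<bar> \<le> B"
  shows "integrable M (\<lambda>x. w x * f x)"
proof -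
  have "norm (f x) \<le> B" for x using assms(3) by simp
  from integrable_bounded_mult[OF assms(1,2) this] show ?thesis by simp
qed

text \<open>Duality: on \<open>K\<close>, the L1 norm of \<open>u (x + h) - u x\<close> is its
  integral against its own sign. The sign is replaced by C1 functions bounded by 1, and a change of
  variables shifts the translation onto these, where \<open>variation_le_translation_test\<close>
  applies.\<close>

lemma variation_le_translation:
  fixes u :: "'a::euclidean_space \<Rightarrow> real"
  assumes u: "variation_le \<Omega> u C" "integrable lborel u"
    and K: "compact K" "(\<Union>x\<in>K. cball x (2 * d)) \<subseteq> \<Omega>" and d: "0 < d" "norm h \<le> d"
  shows "(\<integral>\<^sup>+x. indicator K x * ennreal \<bar>u (x + h) - u x\<bar> \<partial>lborel) \<le> ennreal (norm h * C)"
proof -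
  have [measurable]: "u \<in> borel_measurable borel" using borel_measurable_integrable[OF u(2)] by simp
  have [measurable]: "K \<in> sets borel" using K(1) by (rule borel_compact)
  define \<psi> where "\<psi> x = indicator K x * sgn (u (x + h) - u x)" for x
  have \<psi>: "\<psi> \<in> borel_measurable borel" unfolding \<psi>_def by measurable
  have \<psi>1: "\<bar>\<psi> x\<bar> \<le> 1" for x by (simp add: \<psi>_def indicator_def sgn_if)
  have \<psi>0: "x \<notin> K \<Longrightarrow> \<psi> x = 0" for x by (simp add: \<psi>_def)
  obtain p P where p: "\<And>n::nat. C1_grad (p n) (P n)" "\<And>n x. \<bar>p n x\<bar> \<le> 1"
    "\<And>n x. x \<notin> (\<Union>y\<in>K. cball y d) \<Longrightarrow> p n x = 0" "AE x in lborel. (\<lambda>n. p n x) \<longlonglongrightarrow> \<psi> x"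
    using C1_approximation_measurable[OF \<psi> \<psi>1 K(1) \<psi>0 d(1)] by blast
  have [measurable]: "p n \<in> borel_measurable borel" for n
    by (intro borel_measurable_continuous_onI C1_grad_continuous[OF p(1)])
  have uh: "integrable lborel (\<lambda>x. u (x + h))"
    using lborel_integral_shift(2)[of u h] u(2) by (simp add: add.commute)
  have le: "(\<integral>x. (u (x + h) - u x) * p n x \<partial>lborel) \<le> norm h * C" for n
  proof -
    have i: "integrable lborel (\<lambda>x. u (x + h) * p n x)" "integrable lborel (\<lambda>x. u x * p n x)"
      "integrable lborel (\<lambda>x. u x * p n (x - h))"
      using p(2) by (auto intro!: integrable_mult_bounded uh u(2))
    have "(\<integral>x. (u (x + h) - u x) * p n x \<partial>lborel) = (\<integral>x. u (x + h) * p n x \<partial>lborel) - (\<integral>x. u x * p n x \<partial>lborel)"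
      using i by (simp add: left_diff_distrib)
    also have "(\<integral>x. u (x + h) * p n x \<partial>lborel) = (\<integral>x. u x * p n (x - h) \<partial>lborel)"
      using lborel_integral_shift(1)[of "\<lambda>x. u x * p n (x - h)" h] by (simp add: add.commute)
    also have "\<dots> - (\<integral>x. u x * p n x \<partial>lborel) = (\<integral>x. u x * (p n (x - h) - p n x) \<partial>lborel)"
      using i by (simp add: right_diff_distrib)
    also have "\<dots> \<le> norm h * C"
    proof (rule variation_le_translation_test[OF u(1) p(1,2) compact_minkowski_sum_cball[OF K(1)] p(3)])
      \<comment> \<open>The margin \<open>2 * d\<close> is spent here: one \<open>d\<close> on
        smoothing the sign, at most another on the segment of length \<open>norm h\<close> swept by
        the test field.\<close>
      have "(\<Union>z\<in>K. cball z (d + norm h)) \<subseteq> (\<Union>z\<in>K. cball z (2 * d))"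
        using d by (intro UN_mono) auto
      from order_trans[OF UN_cball_UN_cball_subset order_trans[OF this K(2)]]
      show "(\<Union>x\<in>(\<Union>z\<in>K. cball z d). cball x (norm h)) \<subseteq> \<Omega>" .
    qed
    finally show ?thesis .
  qed
  have "(\<lambda>n. \<integral>x. (u (x + h) - u x) * p n x \<partial>lborel) \<longlonglongrightarrow> (\<integral>x. (u (x + h) - u x) * \<psi> x \<partial>lborel)"
  proof (rule integral_dominated_convergence[where w="\<lambda>x. \<bar>u (x + h) - u x\<bar>"])
    show "AE x in lborel. (\<lambda>n. (u (x + h) - u x) * p n x) \<longlonglongrightarrow> (u (x + h) - u x) * \<psi> x"
      using p(4) by (auto elim!: eventually_mono intro!: tendsto_intros)
    show "AE x in lborel. norm ((u (x + h) - u x) * p n x) \<le> \<bar>u (x + h) - u x\<bar>" for n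
      using p(2)[of n] by (auto simp: abs_mult intro!: mult_left_le)
  qed (use uh u(2) in \<open>auto simp: \<psi>_def\<close>)
  then have "(\<integral>x. (u (x + h) - u x) * \<psi> x \<partial>lborel) \<le> norm h * C"
    using le by (intro LIMSEQ_le_const2) auto
  also have "(\<lambda>x. (u (x + h) - u x) * \<psi> x) = (\<lambda>x. indicator K x * \<bar>u (x + h) - u x\<bar>)"
    by (auto simp: \<psi>_def indicator_def abs_sgn)
  finally have *: "(\<integral>x. indicator K x * \<bar>u (x + h) - u x\<bar> \<partial>lborel) \<le> norm h * C" .
  have "integrable lborel (\<lambda>x. \<bar>u (x + h) - u x\<bar> * indicator K x)"
    using uh u(2) by (intro integrable_mult_bounded[where B=1]) (auto simp: indicator_def)
  then have "(\<integral>\<^sup>+x. ennreal (indicator K x * \<bar>u (x + h) - u x\<bar>) \<partial>lborel)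
      = ennreal (\<integral>x. indicator K x * \<bar>u (x + h) - u x\<bar> \<partial>lborel)"
    by (intro nn_integral_eq_integral) (auto simp: mult.commute)
  with * show ?thesis
    by (simp add: ennreal_mult ennreal_indicator ennreal_leI)
qed

lemma variation_le_nonneg:
  assumes "variation_le \<Omega> u C"
  shows "0 \<le> C"
proof -
  have "(\<lambda>_::'a. 0::'a) \<in> C1_compactly_supported \<Omega>"
    by (rule C1_compactly_supportedI[where G="\<lambda>_ _. 0" and K="{}"]) (auto simp: C1_grad_def)
  from variation_leD[OF assms this] show ?thesis by (simp add: divergence_def)
qed

text \<open>Pointwise, the distance is at most the average of
  \<open>\<bar>u (x + h) - u x\<bar>\<close> over \<open>h\<close> with weight
  \<open>\<rho> h\<close>. After exchanging the integrals, the inner one is the translation estimate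
  with \<open>norm h \<le> e\<close>, and the kernel has mass 1.\<close>

lemma mollify_L1_distance:
  fixes u :: "'a::euclidean_space \<Rightarrow> real"
  assumes m: "mollifier e \<rho> G" and u: "variation_le \<Omega> u C" "integrable lborel u"
    and K: "compact K" "(\<Union>x\<in>K. cball x (2 * d)) \<subseteq> \<Omega>" and d: "0 < d" "0 \<le> e" "e \<le> d"
  shows "integrable lborel (\<lambda>x. indicator K x * \<bar>(\<integral>y. u y * \<rho> (x - y) \<partial>lborel) - u x\<bar>)"
    and "(\<integral>x. indicator K x * \<bar>(\<integral>y. u y * \<rho> (x - y) \<partial>lborel) - u x\<bar> \<partial>lborel) \<le> e * C"
proof -
  have [measurable]: "u \<in> borel_measurable borel" using borel_measurable_integrable[OF u(2)] by simp
  have [measurable]: "K \<in> sets borel" using K(1) by (rule borel_compact)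
  note [measurable] = mollifier_measurable[OF m]
  have C: "0 \<le> C" by (rule variation_le_nonneg[OF u(1)])
  define v where "v x = (\<integral>y. u y * \<rho> (x - y) \<partial>lborel)" for x
  have v: "continuous_on UNIV v"
    unfolding v_def[abs_def] by (rule C1_grad_continuous[OF mollify_C1(1)[OF m u(2)]])
  then have [measurable]: "v \<in> borel_measurable borel" by (rule borel_measurable_continuous_onI)
  have "integrable lborel (\<lambda>x. indicator K x *\<^sub>R v x)"
    by (intro borel_integrable_compact K continuous_on_subset[OF v]) auto
  moreover have "integrable lborel (\<lambda>x. u x * indicator K x)"
    using u(2) by (intro integrable_mult_bounded[where B=1]) (auto simp: indicator_def)
  ultimately have "integrable lborel (\<lambda>x. \<bar>indicator K x *\<^sub>R v x - u x * indicator K x\<bar>)"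
    by simp
  also have "(\<lambda>x. \<bar>indicator K x *\<^sub>R v x - u x * indicator K x\<bar>) = (\<lambda>x. indicator K x * \<bar>v x - u x\<bar>)"
    by (auto simp: indicator_def)
  finally have int: "integrable lborel (\<lambda>x. indicator K x * \<bar>v x - u x\<bar>)" .
  then show "integrable lborel (\<lambda>x. indicator K x * \<bar>(\<integral>y. u y * \<rho> (x - y) \<partial>lborel) - u x\<bar>)"
    by (simp add: v_def)
  have pt: "ennreal \<bar>v x - u x\<bar> \<le> (\<integral>\<^sup>+h. ennreal (\<rho> h) * ennreal \<bar>u (x + h) - u x\<bar> \<partial>lborel)" for x
  proof -
    have i: "integrable lborel (\<lambda>y. (u y - u x) * \<rho> (x - y))"
      unfolding left_diff_distrib
      by (intro Bochner_Integration.integrable_diff mollify_C1[OF m u(2)] integrable_mult_right mollifier_integrable[OF m])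
    have "ennreal \<bar>v x - u x\<bar> = ennreal (norm (\<integral>y. (u y - u x) * \<rho> (x - y) \<partial>lborel))"
      unfolding v_def mollify_minus[OF m u(2)] by simp
    also have "\<dots> \<le> (\<integral>\<^sup>+y. ennreal (norm ((u y - u x) * \<rho> (x - y))) \<partial>lborel)"
      by (rule integral_norm_bound_ennreal[OF i])
    also have "\<dots> = (\<integral>\<^sup>+h. ennreal (norm ((u (x + h) - u x) * \<rho> (x - (x + h)))) \<partial>lborel)"
      by (rule lborel_nn_integral_shift[symmetric]) measurable
    also have "\<dots> = (\<integral>\<^sup>+h. ennreal (\<rho> h) * ennreal \<bar>u (x + h) - u x\<bar> \<partial>lborel)"
      using mollifier_even[OF m, of 0] mollifier_nonneg[OF m]
      by (intro nn_integral_cong) (auto simp: abs_mult ennreal_mult mult.commute)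
    finally show ?thesis .
  qed
  have "(\<integral>\<^sup>+x. ennreal (indicator K x * \<bar>v x - u x\<bar>) \<partial>lborel)
      = (\<integral>\<^sup>+x. indicator K x * ennreal \<bar>v x - u x\<bar> \<partial>lborel)"
    by (simp add: ennreal_mult ennreal_indicator)
  also have "\<dots> \<le> (\<integral>\<^sup>+x. indicator K x * (\<integral>\<^sup>+h. ennreal (\<rho> h) * ennreal \<bar>u (x + h) - u x\<bar> \<partial>lborel) \<partial>lborel)"
    by (intro nn_integral_mono mult_left_mono pt) auto
  also have "\<dots> = (\<integral>\<^sup>+x. (\<integral>\<^sup>+h. indicator K x * (ennreal (\<rho> h) * ennreal \<bar>u (x + h) - u x\<bar>) \<partial>lborel) \<partial>lborel)"
    by (intro nn_integral_cong nn_integral_cmult[symmetric]) measurable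
  also have "\<dots> = (\<integral>\<^sup>+h. (\<integral>\<^sup>+x. indicator K x * (ennreal (\<rho> h) * ennreal \<bar>u (x + h) - u x\<bar>) \<partial>lborel) \<partial>lborel)"
    by (rule lborel_pair.Fubini') measurable
  also have "\<dots> = (\<integral>\<^sup>+h. ennreal (\<rho> h) * (\<integral>\<^sup>+x. indicator K x * ennreal \<bar>u (x + h) - u x\<bar> \<partial>lborel) \<partial>lborel)"
    by (intro nn_integral_cong) (subst nn_integral_cmult[symmetric], auto simp: ac_simps)
  also have "\<dots> \<le> (\<integral>\<^sup>+h. ennreal (\<rho> h) * ennreal (e * C) \<partial>lborel)"
  proof (rule nn_integral_mono)
    fix h
    show "ennreal (\<rho> h) * (\<integral>\<^sup>+x. indicator K x * ennreal \<bar>u (x + h) - u x\<bar> \<partial>lborel) \<le> ennreal (\<rho> h) * ennreal (e * C)"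
    proof (cases "norm h \<le> e")
      case True
      have "(\<integral>\<^sup>+x. indicator K x * ennreal \<bar>u (x + h) - u x\<bar> \<partial>lborel) \<le> ennreal (norm h * C)"
        using True d by (intro variation_le_translation[OF u K d(1)]) auto
      also have "\<dots> \<le> ennreal (e * C)" using True C by (intro ennreal_leI mult_right_mono)
      finally show ?thesis by (intro mult_left_mono) auto
    qed (use mollifier_support[OF m, of h] in auto)
  qed
  also have "\<dots> = (\<integral>\<^sup>+h. ennreal (\<rho> h) \<partial>lborel) * ennreal (e * C)"
    by (rule nn_integral_multc) measurable
  also have "(\<integral>\<^sup>+h. ennreal (\<rho> h) \<partial>lborel) = 1"
    using mollifier_integrable(2)[OF m, of 0] mollifier_integral(2)[OF m, of 0] mollifier_nonneg[OF m]
    by (subst nn_integral_eq_integral) auto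
  finally have "ennreal (\<integral>x. indicator K x * \<bar>v x - u x\<bar> \<partial>lborel) \<le> ennreal (e * C)"
    using nn_integral_eq_integral[OF int] by simp
  then show "(\<integral>x. indicator K x * \<bar>(\<integral>y. u y * \<rho> (x - y) \<partial>lborel) - u x\<bar> \<partial>lborel) \<le> e * C"
    using C d by (simp add: v_def)
qed

text \<open>For a fixed test field the pairing converges by dominated convergence: the divergence is
  integrable, which handles the constant \<open>M\<close>, and bounded, which handles
  \<open>g\<close>.\<close>

lemma variation_le_limit:
  fixes u :: "nat \<Rightarrow> 'a::euclidean_space \<Rightarrow> real"
  assumes u: "\<And>n. variation_le \<Omega> (u n) C" "\<And>n. u n \<in> borel_measurable borel" "v \<in> borel_measurable borel"
    and lim: "AE x in lborel. (\<lambda>n. u n x) \<longlonglongrightarrow> v x"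
    and g: "integrable lborel g" "\<And>n x. \<bar>u n x\<bar> \<le> M + \<bar>g x\<bar>"
  shows "variation_le \<Omega> v C"
  unfolding variation_le_def
proof (intro ballI impI)
  fix \<phi> :: "'a \<Rightarrow> 'a" assume \<phi>: "\<phi> \<in> C1_compactly_supported \<Omega>" "\<forall>x. norm (\<phi> x) \<le> 1"
  obtain G K where "\<And>b. b \<in> Basis \<Longrightarrow> C1_grad (\<lambda>x. \<phi> x \<bullet> b) (G b)"
    and K: "compact K" "K \<subseteq> \<Omega>" "\<And>x. x \<notin> K \<Longrightarrow> \<phi> x = 0"
    and "\<And>x. divergence \<phi> x = (\<Sum>b\<in>Basis. G b x \<bullet> b)"
    and div: "continuous_on UNIV (divergence \<phi>)" "\<And>x. x \<notin> K \<Longrightarrow> divergence \<phi> x = 0"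
    using C1_compactly_supportedE[OF \<phi>(1)] by blast
  obtain B where B: "\<And>x. norm (divergence \<phi> x) \<le> B"
    using bounded_continuous_compact_support[OF div(1) K(1) div(2)] by metis
  have [measurable]: "divergence \<phi> \<in> borel_measurable borel"
    by (rule borel_measurable_continuous_onI[OF div(1)])
  note [measurable] = u(2,3)
  have div: "integrable lborel (divergence \<phi>)"
    by (rule integrable_continuous_compact_support[OF div(1) K(1) div(2)])
  have "(\<lambda>n. \<integral>x. u n x * divergence \<phi> x \<partial>lborel) \<longlonglongrightarrow> (\<integral>x. v x * divergence \<phi> x \<partial>lborel)"
  proof (rule integral_dominated_convergence[where w="\<lambda>x. M * \<bar>divergence \<phi> x\<bar> + \<bar>g x\<bar> * \<bar>divergence \<phi> x\<bar>"])
    show "integrable lborel (\<lambda>x. M * \<bar>divergence \<phi> x\<bar> + \<bar>g x\<bar> * \<bar>divergence \<phi> x\<bar>)"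
      using g(1) div B
      by (intro Bochner_Integration.integrable_add integrable_mult_right[OF integrable_abs]
          integrable_mult_bounded[where B=B and w="\<lambda>x. \<bar>g x\<bar>"]) auto
    show "AE x in lborel. (\<lambda>n. u n x * divergence \<phi> x) \<longlonglongrightarrow> v x * divergence \<phi> x"
      using lim by (auto elim!: eventually_mono intro!: tendsto_intros)
    show "AE x in lborel. norm (u n x * divergence \<phi> x) \<le> M * \<bar>divergence \<phi> x\<bar> + \<bar>g x\<bar> * \<bar>divergence \<phi> x\<bar>" for n
      using g(2)[of n] by (auto simp: abs_mult distrib_right[symmetric] intro!: mult_right_mono)
  qed auto
  then show "(\<integral>x. v x * divergence \<phi> x \<partial>lborel) \<le> C"
    using variation_leD[OF u(1) \<phi>(1)] \<phi>(2) by (intro LIMSEQ_le_const2) auto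
qed

section \<open>Truncation\<close>

lemma C1_compactly_supported_continuous:
  assumes "\<phi> \<in> C1_compactly_supported \<Omega>"
  shows "continuous_on UNIV \<phi>"
proof -
  obtain \<phi>' where "\<And>x. (\<phi> has_derivative blinfun_apply (\<phi>' x)) (at x)"
    using assms unfolding C1_compactly_supported_def by blast
  then show ?thesis by (intro continuous_at_imp_continuous_on ballI has_derivative_continuous)
qed

lemma integrable_lborel_product:
  fixes f g :: "'a::euclidean_space \<Rightarrow> real"
  assumes f: "integrable lborel f" and g: "integrable lborel g"
  shows "integrable (lborel \<Otimes>\<^sub>M lborel) (\<lambda>(x, y). f x * g y)"
proof -
  note [measurable] = borel_measurable_integrable[OF f] borel_measurable_integrable[OF g]
  show ?thesis
  proof (rule lborel_pair.Fubini_integrable)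
    show "(\<lambda>(x, y). f x * g y) \<in> borel_measurable (lborel \<Otimes>\<^sub>M lborel)" by measurable
    show "integrable lborel (\<lambda>x. \<integral>y. norm (case (x, y) of (x, y) \<Rightarrow> f x * g y) \<partial>lborel)"
      using f g by (simp add: abs_mult)
    show "AE x in lborel. integrable lborel (\<lambda>y. case (x, y) of (x, y) \<Rightarrow> f x * g y)"
      using g by simp
  qed
qed

text \<open>Integration by parts without boundary terms: each
  \<open>T (v x) * (\<phi> x \<bullet> b)\<close> has compact support, so its gradient integrates to
  0. Summing the \<open>b\<close>-th components of these gradients over the basis gives the
  identity.\<close>

lemma integral_compose_eq_dual:
  fixes v :: "'a::euclidean_space \<Rightarrow> real" and \<phi> :: "'a \<Rightarrow> 'a"
  assumes v: "C1_grad v V" and T: "\<And>s. (T has_real_derivative T' s) (at s)" "continuous_on UNIV T'"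
    and \<phi>: "\<phi> \<in> C1_compactly_supported \<Omega>"
  shows "(\<integral>x. T (v x) * divergence \<phi> x \<partial>lborel) = - (\<integral>x. T' (v x) * (V x \<bullet> \<phi> x) \<partial>lborel)"
proof -
  obtain G K where G: "\<And>b. b \<in> Basis \<Longrightarrow> C1_grad (\<lambda>x. \<phi> x \<bullet> b) (G b)"
    and K: "compact K" "K \<subseteq> \<Omega>" "\<And>x. x \<notin> K \<Longrightarrow> \<phi> x = 0"
    and divG: "\<And>x. divergence \<phi> x = (\<Sum>b\<in>Basis. G b x \<bullet> b)"
    and div: "continuous_on UNIV (divergence \<phi>)" "\<And>x. x \<notin> K \<Longrightarrow> divergence \<phi> x = 0"
    using C1_compactly_supportedE[OF \<phi>] by blast
  let ?F = "\<lambda>b x. T (v x) *\<^sub>R G b x + (\<phi> x \<bullet> b) *\<^sub>R (T' (v x) *\<^sub>R V x)"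
  have C: "C1_grad (\<lambda>x. T (v x) * (\<phi> x \<bullet> b)) (?F b)" if "b \<in> Basis" for b
    using C1_grad_mult[OF C1_grad_compose[OF T v] G[OF that]] .
  have F0: "?F b x = 0" if "b \<in> Basis" "x \<notin> K" for b x
    by (rule C1_grad_zero_outside[OF C[OF that(1)] compact_imp_closed[OF K(1)] _ that(2)])
       (simp add: K(3))
  have int: "integrable lborel (?F b)" if "b \<in> Basis" for b
    by (rule integrable_continuous_compact_support[OF C1_grad_continuous_grad[OF C[OF that]] K(1) F0[OF that]])
  have zero: "(\<integral>x. ?F b x \<bullet> b \<partial>lborel) = 0" if "b \<in> Basis" for b
    using integral_gradient_eq_0[OF C[OF that] K(1)] K(3) int[OF that] by simp
  have "(\<Sum>b\<in>Basis. ?F b x \<bullet> b) = T (v x) * divergence \<phi> x + T' (v x) * (V x \<bullet> \<phi> x)" for x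
    by (simp add: divG inner_add_left sum.distrib sum_distrib_left euclidean_inner[of "V x" "\<phi> x"] mult.commute mult.left_commute)
  then have "(\<integral>x. T (v x) * divergence \<phi> x + T' (v x) * (V x \<bullet> \<phi> x) \<partial>lborel)
      = (\<integral>x. (\<Sum>b\<in>Basis. ?F b x \<bullet> b) \<partial>lborel)" by simp
  also have "\<dots> = (\<Sum>b\<in>Basis. \<integral>x. ?F b x \<bullet> b \<partial>lborel)"
    by (intro Bochner_Integration.integral_sum integrable_inner_left int)
  also have "\<dots> = 0" using zero by simp
  finally have *: "(\<integral>x. T (v x) * divergence \<phi> x + T' (v x) * (V x \<bullet> \<phi> x) \<partial>lborel) = 0" .
  have Tv: "continuous_on UNIV (\<lambda>x. T (v x))"
    by (rule C1_grad_continuous[OF C1_grad_compose[OF T v]])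
  note \<phi>c = C1_compactly_supported_continuous[OF \<phi>]
  have "integrable lborel (\<lambda>x. T (v x) * divergence \<phi> x)"
    by (rule integrable_continuous_compact_support[OF _ K(1)]) (auto intro!: continuous_intros Tv div)
  moreover have "integrable lborel (\<lambda>x. T' (v x) * (V x \<bullet> \<phi> x))"
    by (rule integrable_continuous_compact_support[OF _ K(1)])
       (auto intro!: continuous_intros \<phi>c C1_grad_continuous_grad[OF v] continuous_on_compose2[OF T(2)]
         C1_grad_continuous[OF v] simp: K(3))
  ultimately show ?thesis using * by simp
qed

text \<open>Integration by parts turns the left-hand side into \<open>\<integral> u div \<Phi>\<close> for the mollification \<open>\<Phi>\<close> of
  \<open>T\<^sup>\<prime>(v) \<phi>\<close>, where \<open>v\<close> is the mollification of \<open>u\<close>; this is an admissible field because \<open>|T\<^sup>\<prime>| \<le> 1\<close>.\<close>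

lemma variation_le_compose_mollified:
  fixes u :: "'a::euclidean_space \<Rightarrow> real"
  assumes m: "mollifier e \<rho> G" and u: "variation_le \<Omega> u C" "integrable lborel u"
    and T: "\<And>s. (T has_real_derivative T' s) (at s)" "continuous_on UNIV T'" "\<And>s. \<bar>T' s\<bar> \<le> 1"
    and \<phi>: "\<phi> \<in> C1_compactly_supported \<Omega>" "\<And>x. norm (\<phi> x) \<le> 1"
    and K: "compact K" "\<And>x. x \<notin> K \<Longrightarrow> \<phi> x = 0" "(\<Union>x\<in>K. cball x e) \<subseteq> \<Omega>" and \<phi>c: "continuous_on UNIV \<phi>"
  shows "(\<integral>x. T (\<integral>y. u y * \<rho> (x - y) \<partial>lborel) * divergence \<phi> x \<partial>lborel) \<le> C"
proof -
  note [measurable] = mollifier_measurable[OF m]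
  have [measurable]: "u \<in> borel_measurable borel" using borel_measurable_integrable[OF u(2)] by simp
  define v where "v x = (\<integral>y. u y * \<rho> (x - y) \<partial>lborel)" for x
  define V where "V x = (\<integral>y. u y *\<^sub>R G (x - y) \<partial>lborel)" for x
  have v: "C1_grad v V" unfolding v_def[abs_def] V_def[abs_def] by (rule mollify_C1[OF m u(2)])
  define \<psi> where "\<psi> x = T' (v x) *\<^sub>R \<phi> x" for x
  have \<psi>c: "continuous_on UNIV \<psi>"
    unfolding \<psi>_def[abs_def]
    by (intro continuous_intros \<phi>c continuous_on_compose2[OF T(2)] C1_grad_continuous[OF v]) auto
  then have [measurable]: "\<psi> \<in> borel_measurable borel" by (rule borel_measurable_continuous_onI)
  have \<psi>0: "x \<notin> K \<Longrightarrow> \<psi> x = 0" for x by (simp add: \<psi>_def K(2))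
  have \<psi>1: "norm (\<psi> x) \<le> 1" for x
    using mult_mono[OF T(3)[of "v x"] \<phi>(2)[of x]] by (simp add: \<psi>_def)
  have \<psi>b: "integrable lborel (\<lambda>x. \<psi> x \<bullet> b)" for b
    by (rule integrable_continuous_compact_support[OF _ K(1)])
       (auto intro!: continuous_intros \<psi>c simp: \<psi>0)
  define \<Phi> where "\<Phi> y = (\<integral>x. \<rho> (y - x) *\<^sub>R \<psi> x \<partial>lborel)" for y
  have i\<Phi>: "integrable lborel (\<lambda>x. \<rho> (y - x) *\<^sub>R \<psi> x)" for y
    by (rule integrable_bounded_mult[OF mollifier_integrable(1)[OF m] _ \<psi>1]) simp
  have comp: "C1_grad (\<lambda>y. \<Phi> y \<bullet> b) (\<lambda>y. \<integral>x. (\<psi> x \<bullet> b) *\<^sub>R G (y - x) \<partial>lborel)" for b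
  proof -
    have "(\<lambda>y. \<Phi> y \<bullet> b) = (\<lambda>y. \<integral>x. (\<psi> x \<bullet> b) * \<rho> (y - x) \<partial>lborel)"
      unfolding \<Phi>_def using i\<Phi> by (subst integral_inner_left[symmetric]) (auto simp: mult.commute)
    with mollify_C1(1)[OF m \<psi>b] show ?thesis by simp
  qed
  have supp: "\<Phi> y = 0" if "y \<notin> (\<Union>x\<in>K. cball x e)" for y
  proof -
    have "\<rho> (y - x) *\<^sub>R \<psi> x = 0" for x
      using that \<psi>0[of x] mollifier_support[OF m, of "y - x"]
      by (cases "x \<in> K") (auto simp: dist_norm norm_minus_commute)
    then have "(\<lambda>x. \<rho> (y - x) *\<^sub>R \<psi> x) = (\<lambda>_. 0)" by (rule ext)
    then show ?thesis by (simp add: \<Phi>_def)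
  qed
  note I = C1_compactly_supportedI[where \<phi>=\<Phi> and G="\<lambda>b y. \<integral>x. (\<psi> x \<bullet> b) *\<^sub>R G (y - x) \<partial>lborel",
      OF comp compact_minkowski_sum_cball[OF K(1)] K(3) supp]
  have n1: "norm (\<Phi> y) \<le> 1" for y
    using norm_integral_weighted_le[OF mollifier_integrable(1)[OF m, of y] _ \<psi>1]
    by (simp add: \<Phi>_def mollifier_nonneg[OF m] mollifier_integral[OF m])
  have le: "(\<integral>y. u y * divergence \<Phi> y \<partial>lborel) \<le> C"
    by (rule variation_leD[OF u(1) I(1) n1])
  have G0: "z \<notin> cball 0 e \<Longrightarrow> G z = 0" for z
    by (rule C1_grad_zero_outside[OF mollifier_C1[OF m] closed_cball mollifier_support[OF m]])
  obtain B where B: "\<And>x. norm (G x) \<le> B"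
    using bounded_continuous_compact_support[OF C1_grad_continuous_grad[OF mollifier_C1[OF m]] compact_cball G0] by metis
  have B0: "0 \<le> B" using B norm_ge_zero order_trans by blast
  have \<psi>G: "\<bar>\<psi> x \<bullet> G z\<bar> \<le> indicator K x * B" for x z
    using order_trans[OF Cauchy_Schwarz_ineq2[of "\<psi> x" "G z"] mult_mono[OF \<psi>1[of x] B[of z]]] \<psi>0[of x]
    by (cases "x \<in> K") auto
  have iG: "integrable lborel (\<lambda>x. (\<psi> x \<bullet> b) *\<^sub>R G (y - x))" for b y
    by (rule integrable_bounded_mult[OF \<psi>b _ B]) simp
  have div: "divergence \<Phi> y = (\<integral>x. \<psi> x \<bullet> G (y - x) \<partial>lborel)" for y
  proof -
    have "divergence \<Phi> y = (\<Sum>b\<in>Basis. (\<integral>x. (\<psi> x \<bullet> b) *\<^sub>R G (y - x) \<partial>lborel) \<bullet> b)" by (rule I(2))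
    also have "\<dots> = (\<Sum>b\<in>Basis. \<integral>x. ((\<psi> x \<bullet> b) *\<^sub>R G (y - x)) \<bullet> b \<partial>lborel)"
      using iG by (subst integral_inner_left) auto
    also have "\<dots> = (\<integral>x. (\<Sum>b\<in>Basis. ((\<psi> x \<bullet> b) *\<^sub>R G (y - x)) \<bullet> b) \<partial>lborel)"
      by (intro Bochner_Integration.integral_sum[symmetric] integrable_inner_left iG)
    also have "\<dots> = (\<integral>x. \<psi> x \<bullet> G (y - x) \<partial>lborel)"
      by (intro Bochner_Integration.integral_cong refl) (simp add: euclidean_inner[of "\<psi> _" "G _"])
    finally show ?thesis .
  qed
  \<comment> \<open>Fubini is justified by a product majorant: \<psi> is supported in
    \<open>K\<close> and bounded by 1, \<open>G\<close> is bounded by \<open>B\<close>, and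
    \<open>u\<close> is integrable.\<close>
  have "integrable (lborel \<Otimes>\<^sub>M lborel) (\<lambda>(x, y). u y * (\<psi> x \<bullet> G (y - x)))"
  proof (rule Bochner_Integration.integrable_bound)
    show "integrable (lborel \<Otimes>\<^sub>M lborel) (\<lambda>(x, y). (indicator K x * B) * u y)"
      using emeasure_compact_finite[OF K(1)] borel_compact[OF K(1)]
      by (intro integrable_lborel_product u(2) integrable_mult_left) auto
    show "(\<lambda>(x, y). u y * (\<psi> x \<bullet> G (y - x))) \<in> borel_measurable (lborel \<Otimes>\<^sub>M lborel)" by measurable
    show "AE z in lborel \<Otimes>\<^sub>M lborel. norm (case z of (x, y) \<Rightarrow> u y * (\<psi> x \<bullet> G (y - x)))
        \<le> norm (case z of (x, y) \<Rightarrow> indicator K x * B * u y)"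
    proof (intro always_eventually allI)
      fix z :: "'a \<times> 'a"
      obtain x y where z: "z = (x, y)" by force
      have "\<bar>\<psi> x \<bullet> G (y - x)\<bar> * \<bar>u y\<bar> \<le> (indicator K x * B) * \<bar>u y\<bar>"
        by (rule mult_right_mono[OF \<psi>G]) simp
      then show "norm (case z of (x, y) \<Rightarrow> u y * (\<psi> x \<bullet> G (y - x)))
        \<le> norm (case z of (x, y) \<Rightarrow> indicator K x * B * u y)"
        using B0 by (simp add: z abs_mult mult.commute)
    qed
  qed
  from lborel_pair.Fubini_integral[OF this]
  have "(\<integral>y. u y * divergence \<Phi> y \<partial>lborel) = (\<integral>x. \<integral>y. u y * (\<psi> x \<bullet> G (y - x)) \<partial>lborel \<partial>lborel)"
    by (simp add: div)
  \<comment> \<open>Oddness of \<open>G\<close> produces the minus sign that cancels the one from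
    integration by parts.\<close>
  also have "\<dots> = (\<integral>x. - (V x \<bullet> \<psi> x) \<partial>lborel)"
  proof (intro Bochner_Integration.integral_cong refl)
    fix x
    have "(\<integral>y. u y * (\<psi> x \<bullet> G (y - x)) \<partial>lborel) = (\<integral>y. - ((u y *\<^sub>R G (x - y)) \<bullet> \<psi> x) \<partial>lborel)"
      by (intro Bochner_Integration.integral_cong refl)
         (simp add: mollifier_grad_odd[OF m, of _ x] inner_commute)
    also have "\<dots> = - (V x \<bullet> \<psi> x)"
      unfolding V_def using mollify_C1(3)[OF m u(2)] by (simp add: integral_inner_left del: inner_scaleR_left)
    finally show "(\<integral>y. u y * (\<psi> x \<bullet> G (y - x)) \<partial>lborel) = - (V x \<bullet> \<psi> x)" .
  qed
  also have "\<dots> = (\<integral>x. T (v x) * divergence \<phi> x \<partial>lborel)"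
    unfolding integral_compose_eq_dual[OF v T(1,2) \<phi>(1)] by (simp add: \<psi>_def)
  finally show ?thesis using le by (simp add: v_def)
qed

text \<open>The bound is known for the mollification \<open>v\<close> in place of \<open>u\<close>.
  Since \<open>T\<close> is 1-Lipschitz, exchanging the two in the pairing costs at most the sup of
  the divergence times the L1 distance on the support of the field, that is
  \<open>B * (e * C)\<close>, which vanishes with \<open>e\<close>.\<close>

lemma variation_le_compose:
  fixes u :: "'a::euclidean_space \<Rightarrow> real"
  assumes \<Omega>: "open \<Omega>" and u: "variation_le \<Omega> u C" "integrable lborel u"
    and T: "\<And>s. (T has_real_derivative T' s) (at s)" "continuous_on UNIV T'" "\<And>s. \<bar>T' s\<bar> \<le> 1"
  shows "variation_le \<Omega> (\<lambda>x. T (u x)) C"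
  unfolding variation_le_def
proof (intro ballI impI)
  fix \<phi> :: "'a \<Rightarrow> 'a" assume \<phi>: "\<phi> \<in> C1_compactly_supported \<Omega>" "\<forall>x. norm (\<phi> x) \<le> 1"
  obtain G K where G: "\<And>b. b \<in> Basis \<Longrightarrow> C1_grad (\<lambda>x. \<phi> x \<bullet> b) (G b)"
    and K: "compact K" "K \<subseteq> \<Omega>" "\<And>x. x \<notin> K \<Longrightarrow> \<phi> x = 0"
    and div: "continuous_on UNIV (divergence \<phi>)" "\<And>x. x \<notin> K \<Longrightarrow> divergence \<phi> x = 0"
    using C1_compactly_supportedE[OF \<phi>(1)] by blast
  note \<phi>c = C1_compactly_supported_continuous[OF \<phi>(1)]
  obtain B where B: "B > 0" "\<And>x. norm (divergence \<phi> x) \<le> B"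
    using bounded_continuous_compact_support[OF div(1) K(1) div(2)] by metis
  obtain d' where d': "d' > 0" "(\<Union>x\<in>K. cball x d') \<subseteq> \<Omega>"
    using compact_subset_open_imp_cball_epsilon_subset[OF K(1) \<Omega> K(2)] by metis
  define d where "d = d' / 2"
  have d: "d > 0" "(\<Union>x\<in>K. cball x (2 * d)) \<subseteq> \<Omega>" using d' by (auto simp: d_def)
  have C: "0 \<le> C" by (rule variation_le_nonneg[OF u(1)])
  have [measurable]: "u \<in> borel_measurable borel" using borel_measurable_integrable[OF u(2)] by simp
  have Tc: "continuous_on UNIV T"
    using T(1) by (intro continuous_at_imp_continuous_on ballI) (metis DERIV_isCont)
  have [measurable]: "T \<in> borel_measurable borel" "divergence \<phi> \<in> borel_measurable borel" "K \<in> sets borel"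
    using Tc div(1) K(1) by (auto intro: borel_measurable_continuous_onI borel_compact)
  have lip: "\<bar>T s - T t\<bar> \<le> \<bar>s - t\<bar>" for s t
    using field_differentiable_bound[of UNIV T T' 1 s t] T(1,3) by (simp add: has_field_derivative_at_within)
  \<comment> \<open>\<open>T\<close> may be unbounded, but a 1-Lipschitz function grows at most
    linearly, and the divergence is both bounded and integrable.\<close>
  have iu: "integrable lborel (\<lambda>x. T (u x) * divergence \<phi> x)"
  proof (rule Bochner_Integration.integrable_bound)
    show "integrable lborel (\<lambda>x. \<bar>T 0\<bar> * \<bar>divergence \<phi> x\<bar> + \<bar>u x\<bar> * \<bar>divergence \<phi> x\<bar>)"
      using B u(2) integrable_continuous_compact_support[OF div(1) K(1) div(2)]
      by (intro Bochner_Integration.integrable_add integrable_mult_right[OF integrable_abs]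
          integrable_mult_bounded[where B=B and w="\<lambda>x. \<bar>u x\<bar>"]) auto
    have "\<bar>T (u x)\<bar> * \<bar>divergence \<phi> x\<bar> \<le> (\<bar>T 0\<bar> + \<bar>u x\<bar>) * \<bar>divergence \<phi> x\<bar>" for x
      using lip[of "u x" 0] by (intro mult_right_mono) auto
    then show "AE x in lborel. norm (T (u x) * divergence \<phi> x)
        \<le> norm (\<bar>T 0\<bar> * \<bar>divergence \<phi> x\<bar> + \<bar>u x\<bar> * \<bar>divergence \<phi> x\<bar>)"
      by (auto simp: abs_mult distrib_right)
  qed measurable
  have step: "(\<integral>x. T (u x) * divergence \<phi> x \<partial>lborel) \<le> C + B * (e * C)" if e: "0 < e" "e \<le> d" for e
  proof -
    obtain \<rho> H where m: "mollifier e \<rho> (H :: 'a \<Rightarrow> 'a)"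
      using mollifier_exists[OF e(1)] by metis
    define v where "v x = (\<integral>y. u y * \<rho> (x - y) \<partial>lborel)" for x
    have v: "continuous_on UNIV v"
      unfolding v_def[abs_def] by (rule C1_grad_continuous[OF mollify_C1(1)[OF m u(2)]])
    note L1 = mollify_L1_distance[OF m u K(1) d(2,1) less_imp_le[OF e(1)] e(2), folded v_def]
    have "(\<Union>x\<in>K. cball x e) \<subseteq> (\<Union>x\<in>K. cball x (2 * d))" using e by (intro UN_mono) auto
    then have Ke: "(\<Union>x\<in>K. cball x e) \<subseteq> \<Omega>" using d(2) by (rule order_trans)
    have le: "(\<integral>x. T (v x) * divergence \<phi> x \<partial>lborel) \<le> C"
      unfolding v_def using \<phi>(2)
      by (intro variation_le_compose_mollified[OF m u T \<phi>(1) _ K(1) K(3) Ke \<phi>c]) auto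
    have iv: "integrable lborel (\<lambda>x. T (v x) * divergence \<phi> x)"
      by (rule integrable_continuous_compact_support[OF _ K(1)])
         (auto intro!: continuous_intros div continuous_on_compose2[OF Tc] v)
    have "(\<integral>x. T (u x) * divergence \<phi> x \<partial>lborel) - (\<integral>x. T (v x) * divergence \<phi> x \<partial>lborel)
        = (\<integral>x. T (u x) * divergence \<phi> x - T (v x) * divergence \<phi> x \<partial>lborel)"
      using iu iv by simp
    also have "\<dots> \<le> (\<integral>x. B * (indicator K x * \<bar>v x - u x\<bar>) \<partial>lborel)"
    proof (rule Bochner_Integration.integral_mono)
      fix x
      show "T (u x) * divergence \<phi> x - T (v x) * divergence \<phi> x \<le> B * (indicator K x * \<bar>v x - u x\<bar>)"
      proof (cases "x \<in> K")
        case True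
        have "(T (u x) - T (v x)) * divergence \<phi> x \<le> \<bar>T (u x) - T (v x)\<bar> * \<bar>divergence \<phi> x\<bar>"
          by (metis abs_ge_self abs_mult)
        also have "\<dots> \<le> \<bar>u x - v x\<bar> * B"
          using B lip by (intro mult_mono) auto
        finally show ?thesis using True by (simp add: algebra_simps abs_minus_commute)
      qed (simp add: div)
    qed (use iu iv L1(1) in auto)
    also have "\<dots> \<le> B * (e * C)"
      using L1(2) B(1) by simp
    finally show ?thesis using le by linarith
  qed
  show "(\<integral>x. T (u x) * divergence \<phi> x \<partial>lborel) \<le> C"
  proof (rule field_le_epsilon)
    fix \<epsilon> :: real assume \<epsilon>: "0 < \<epsilon>"
    \<comment> \<open>\<open>C + 1\<close> keeps the denominator positive when
      \<open>C = 0\<close>.\<close>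
    define e where "e = min d (\<epsilon> / (B * (C + 1)))"
    have BC: "0 < B * (C + 1)" using B C by simp
    have "e \<le> \<epsilon> / (B * (C + 1))" by (simp add: e_def)
    then have "e * (B * (C + 1)) \<le> \<epsilon>" using pos_le_divide_eq[OF BC] by blast
    moreover have e: "0 < e" "e \<le> d" using d \<epsilon> BC by (auto simp: e_def)
    moreover have "B * (e * C) \<le> e * (B * (C + 1))" using B C e by (simp add: algebra_simps)
    ultimately show "(\<integral>x. T (u x) * divergence \<phi> x \<partial>lborel) \<le> C + \<epsilon>"
      using step[of e] by linarith
  qed
qed

section \<open>From C1 functions to the clamp\<close>

text \<open>\<open>sqrt (s\<^sup>2 + \<delta>\<^sup>2)\<close> exceeds \<open>\<bar>s\<bar>\<close>
  by at most \<delta> and has slope at most 1 in absolute value, and minimum and maximum are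
  expressible through the absolute value.\<close>

lemma smooth_clamp:
  fixes a b :: real
  assumes "0 < \<delta>"
  obtains T T' where "\<And>s. (T has_real_derivative T' s) (at s)" "continuous_on UNIV T'"
    "\<And>s. \<bar>T' s\<bar> \<le> 1" "\<And>s. \<bar>T s - min b (max a s)\<bar> \<le> \<delta>"
proof -
  define r where "r s = sqrt (s\<^sup>2 + \<delta>\<^sup>2)" for s
  have pos: "0 < s\<^sup>2 + \<delta>\<^sup>2" for s using assms by (simp add: add_nonneg_pos)
  have r: "(r has_real_derivative s / r s) (at s)" for s
    unfolding r_def[abs_def] using pos[of s]
    by (auto intro!: derivative_eq_intros simp: divide_simps)
  have r0: "r s \<noteq> 0" for s using pos[of s] unfolding r_def by (metis less_irrefl real_sqrt_eq_0_iff)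
  have rc: "continuous_on S r" for S unfolding r_def[abs_def] by (intro continuous_intros)
  have rl: "\<bar>s\<bar> \<le> r s" "r s \<le> \<bar>s\<bar> + \<delta>" for s
  proof -
    show "\<bar>s\<bar> \<le> r s" unfolding r_def by (rule real_le_rsqrt) simp
    show "r s \<le> \<bar>s\<bar> + \<delta>" unfolding r_def using assms
      by (intro real_le_lsqrt) (auto simp: power2_sum)
  qed
  have q: "\<bar>s / r s\<bar> \<le> 1" for s
    using rl(1)[of s] r0[of s] abs_ge_zero[of s] by (simp add: abs_divide divide_le_eq_1 abs_of_nonneg) linarith
  \<comment> \<open>\<open>max a s = (s + a + \<bar>s - a\<bar>) / 2\<close> and
    \<open>min b s = (s + b - \<bar>s - b\<bar>) / 2\<close>, with \<open>r\<close> for the absolute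
    value. Each is off by at most half of \<delta>, and since \<open>min b\<close> is 1-Lipschitz
    the errors add up to \<delta>.\<close>
  define P where "P s = (s + a + r (s - a)) / 2" for s
  define P' where "P' s = (1 + (s - a) / r (s - a)) / 2" for s
  define Q where "Q s = (s + b - r (s - b)) / 2" for s
  define Q' where "Q' s = (1 - (s - b) / r (s - b)) / 2" for s
  have P: "(P has_real_derivative P' s) (at s)" for s
    unfolding P_def[abs_def] P'_def
    by (auto intro!: derivative_eq_intros DERIV_chain2[OF r])
  have Q: "(Q has_real_derivative Q' s) (at s)" for s
    unfolding Q_def[abs_def] Q'_def
    by (auto intro!: derivative_eq_intros DERIV_chain2[OF r])
  have P1: "\<bar>P' s\<bar> \<le> 1" and Q1: "\<bar>Q' s\<bar> \<le> 1" for s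
    using q[of "s - a"] q[of "s - b"] unfolding P'_def Q'_def abs_le_iff by auto
  have Pm: "\<bar>P s - max a s\<bar> \<le> \<delta> / 2" and Qm: "\<bar>Q s - min b s\<bar> \<le> \<delta> / 2" for s
    using rl[of "s - a"] rl[of "s - b"] by (auto simp: P_def Q_def abs_if max_def min_def field_simps split: if_splits)
  show thesis
  proof (rule that)
    show "((\<lambda>s. Q (P s)) has_real_derivative Q' (P s) * P' s) (at s)" for s
      by (rule DERIV_chain2[OF Q P])
    show "continuous_on UNIV (\<lambda>s. Q' (P s) * P' s)"
      unfolding Q'_def P'_def P_def
      by (intro continuous_intros continuous_on_compose2[OF rc[of UNIV]]) (auto simp: r0)
    show "\<bar>Q' (P s) * P' s\<bar> \<le> 1" for s
      using mult_mono[OF Q1[of "P s"] P1[of s]] by (simp add: abs_mult)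
    show "\<bar>Q (P s) - min b (max a s)\<bar> \<le> \<delta>" for s
      using Qm[of "P s"] Pm[of s] by linarith
  qed
qed

text \<open>The constant \<open>C\<close> is the same for every smoothed clamp, so it survives the
  limit as the smoothing error \<open>1 / real (Suc n)\<close> tends to 0.\<close>

lemma variation_le_clamp:
  fixes u :: "'a::euclidean_space \<Rightarrow> real"
  assumes \<Omega>: "open \<Omega>" and u: "variation_le \<Omega> u C" "integrable lborel u"
  shows "variation_le \<Omega> (\<lambda>x. min b (max a (u x))) C"
proof -
  have [measurable]: "u \<in> borel_measurable borel" using borel_measurable_integrable[OF u(2)] by simp
  have "\<exists>T. variation_le \<Omega> (\<lambda>x. T (u x)) C \<and> (\<lambda>x. T (u x)) \<in> borel_measurable borel \<and>
      (\<forall>s. \<bar>T s - min b (max a s)\<bar> \<le> 1 / real (Suc n))" for n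
  proof -
    obtain T T' where T: "\<And>s. (T has_real_derivative T' s) (at s)" "continuous_on UNIV T'"
      "\<And>s. \<bar>T' s\<bar> \<le> 1" "\<And>s. \<bar>T s - min b (max a s)\<bar> \<le> 1 / real (Suc n)"
      using smooth_clamp[of "1 / real (Suc n)" b a] by (metis of_nat_0_less_iff zero_less_Suc zero_less_divide_1_iff)
    have "continuous_on UNIV T"
      using T(1) by (intro continuous_at_imp_continuous_on ballI) (metis DERIV_isCont)
    then have [measurable]: "T \<in> borel_measurable borel" by (rule borel_measurable_continuous_onI)
    show ?thesis
      using variation_le_compose[OF \<Omega> u T(1-3)] T(4) by (intro exI[of _ T]) auto
  qed
  then obtain T where T: "\<And>n. variation_le \<Omega> (\<lambda>x. T n (u x)) C"
    "\<And>n. (\<lambda>x. T n (u x)) \<in> borel_measurable borel"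
    "\<And>n s. \<bar>T n s - min b (max a s)\<bar> \<le> 1 / real (Suc n)" by metis
  show ?thesis
  proof (rule variation_le_limit[OF T(1,2) _ _ u(2), where M="1 + \<bar>a\<bar> + \<bar>b\<bar>"])
    have "(\<lambda>n. T n s) \<longlonglongrightarrow> min b (max a s)" for s
      by (rule LIM_zero_cancel, rule Lim_null_comparison[OF _ LIMSEQ_Suc[OF lim_1_over_n]]) (use T(3) in auto)
    then show "AE x in lborel. (\<lambda>n. T n (u x)) \<longlonglongrightarrow> min b (max a (u x))" by simp
    show "\<bar>T n (u x)\<bar> \<le> 1 + \<bar>a\<bar> + \<bar>b\<bar> + \<bar>u x\<bar>" for n x
    proof -
      have "1 / real (Suc n) \<le> 1" by simp
      then have "\<bar>T n (u x) - min b (max a (u x))\<bar> \<le> 1" using T(3)[of n "u x"] by linarith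
      then show ?thesis by (auto simp: min_def max_def abs_if split: if_splits)
    qed
  qed simp
qed

section \<open>Compactness\<close>

lemma compact_subset_measure_diff_less:
  fixes \<Omega> :: "'a::euclidean_space set"
  assumes "open \<Omega>" "emeasure lborel \<Omega> < \<infinity>" "0 < e"
  obtains K where "compact K" "K \<subseteq> \<Omega>" "measure lborel (\<Omega> - K) < e"
proof -
  obtain A where A: "\<And>n::nat. compact (A n)" "\<And>n. A n \<subseteq> \<Omega>" "\<And>n. A n \<subseteq> interior (A (Suc n))" "\<Union>(range A) = \<Omega>"
    using open_Union_compact_subsets[OF assms(1)] by metis
  have "incseq A" using A(3) interior_subset by (intro incseq_SucI) blast
  then have "(\<lambda>n. measure lborel (A n)) \<longlonglongrightarrow> measure lborel (\<Union>n. A n)"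
    using A assms(2) by (intro Lim_measure_incseq) (auto simp: borel_compact less_top)
  then have "\<forall>\<^sub>F n in sequentially. measure lborel \<Omega> - e < measure lborel (A n)"
    using A(4) \<open>0 < e\<close> by (intro order_tendstoD(1)) auto
  then obtain n where n: "measure lborel \<Omega> - e < measure lborel (A n)"
    by (auto simp: eventually_sequentially)
  have "measure lborel (\<Omega> - A n) = measure lborel \<Omega> - measure lborel (A n)"
    using A(1,2)[of n] assms by (intro measure_Diff) (auto simp: borel_compact less_top)
  with n A(1,2)[of n] that show thesis by auto
qed

text \<open>At a fixed scale the mollifications are equicontinuous, because the kernel is uniformly
  continuous and the L1 norms are bounded by \<open>L\<close>. Convergence on a dense set, which a
  diagonal argument can supply when the set is countable, then spreads to all points.\<close>

lemma mollified_convergence_everywhere: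
  fixes u :: "nat \<Rightarrow> 'a::euclidean_space \<Rightarrow> real"
  assumes m: "mollifier e \<rho> G" and u: "\<And>n. integrable lborel (u n)" "\<And>n. (\<integral>x. \<bar>u n x\<bar> \<partial>lborel) \<le> L"
    and D: "\<And>X. open X \<Longrightarrow> X \<noteq> {} \<Longrightarrow> \<exists>q\<in>D. q \<in> X"
    and conv: "\<And>q. q \<in> D \<Longrightarrow> convergent (\<lambda>n. \<integral>y. u n y * \<rho> (q - y) \<partial>lborel)"
  shows "convergent (\<lambda>n. \<integral>y. u n y * \<rho> (x - y) \<partial>lborel)"
  unfolding Cauchy_convergent_iff[symmetric]
proof (rule metric_CauchyI)
  fix c :: real assume c: "0 < c"
  note [measurable] = mollifier_measurable[OF m]
  have L: "0 \<le> L" using order_trans[OF _ u(2)[of 0]] by simp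
  \<comment> \<open>Chosen so that moving from \<open>x\<close> to the nearby dense point
    \<open>q\<close> costs at most \<open>c / 4\<close>, twice; the Cauchy property at
    \<open>q\<close> costs another quarter, leaving strict room below \<open>c\<close>.\<close>
  define \<eta> where "\<eta> = c / (4 * (L + 1))"
  have \<eta>: "0 < \<eta>" "L * \<eta> \<le> c / 4" using c L by (auto simp: \<eta>_def field_simps)
  obtain d where d: "0 < d" "\<And>z z'. dist z z' < d \<Longrightarrow> dist (\<rho> z) (\<rho> z') < \<eta>"
    using uniformly_continuous_compact_support[OF C1_grad_continuous[OF mollifier_C1[OF m]] compact_cball mollifier_support[OF m] \<eta>(1)] by metis
  obtain q where q: "q \<in> D" "dist x q < d" using D[of "ball x d"] d(1) by auto
  let ?v = "\<lambda>n x. \<integral>y. u n y * \<rho> (x - y) \<partial>lborel"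
  have close: "\<bar>?v n x - ?v n q\<bar> \<le> c / 4" for n
  proof -
    have r: "norm (\<rho> (x - y) - \<rho> (q - y)) \<le> \<eta>" for y
      using d(2)[of "x - y" "q - y"] q(2) by (simp add: dist_norm)
    have "?v n x - ?v n q = (\<integral>y. u n y *\<^sub>R (\<rho> (x - y) - \<rho> (q - y)) \<partial>lborel)"
      using mollify_C1(2)[OF m u(1)] by (simp add: right_diff_distrib)
    also have "norm \<dots> \<le> (\<integral>y. \<bar>u n y\<bar> \<partial>lborel) * \<eta>"
      by (rule norm_integral_weighted_le[OF u(1) _ r]) simp
    also have "\<dots> \<le> L * \<eta>" using u(2) \<eta>(1) by (intro mult_right_mono) auto
    finally show ?thesis using \<eta>(2) by simp
  qed
  have "Cauchy (\<lambda>n. ?v n q)" using conv[OF q(1)] by (simp add: Cauchy_convergent_iff)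
  then obtain N where N: "\<And>i j. i \<ge> N \<Longrightarrow> j \<ge> N \<Longrightarrow> dist (?v i q) (?v j q) < c / 4"
    using c metric_CauchyD[of "\<lambda>n. ?v n q" "c / 4"] by auto
  show "\<exists>N. \<forall>i\<ge>N. \<forall>j\<ge>N. dist (?v i x) (?v j x) < c"
  proof (intro exI[of _ N] allI impI)
    fix i j assume "i \<ge> N" "j \<ge> N"
    from N[OF this] close[of i] close[of j] c show "dist (?v i x) (?v j x) < c"
      unfolding dist_real_def by linarith
  qed
qed

lemma bounded_support_integrable:
  fixes u :: "'a::euclidean_space \<Rightarrow> real"
  assumes "emeasure lborel \<Omega> < \<infinity>" "\<Omega> \<in> sets borel" "u \<in> borel_measurable borel"
    "\<And>x. \<bar>u x\<bar> \<le> M" "\<And>x. x \<notin> \<Omega> \<Longrightarrow> u x = 0"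
  shows "integrable lborel u" and "(\<integral>x. \<bar>u x\<bar> \<partial>lborel) \<le> M * measure lborel \<Omega>"
proof -
  have i: "integrable lborel (\<lambda>x. M * indicator \<Omega> x)"
    using assms(1,2) by (intro integrable_mult_right) simp
  have le: "\<bar>u x\<bar> \<le> M * indicator \<Omega> x" for x using assms(4,5)[of x] by (auto simp: indicator_def)
  show u: "integrable lborel u"
    by (rule Bochner_Integration.integrable_bound[OF i])
       (use assms(3) le abs_ge_self order_trans in \<open>auto, blast\<close>)
  have "(\<integral>x. \<bar>u x\<bar> \<partial>lborel) \<le> (\<integral>x. M * indicator \<Omega> x \<partial>lborel)"
    using u i le by (intro Bochner_Integration.integral_mono) auto
  then show "(\<integral>x. \<bar>u x\<bar> \<partial>lborel) \<le> M * measure lborel \<Omega>" using assms(1,2) by simp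
qed

text \<open>Off a large compact \<open>K\<close> the uniform bound acts on a set of small measure.
  On \<open>K\<close>, each \<open>u n\<close> is close in L1 to its mollification uniformly in
  \<open>n\<close>, and at a fixed scale the mollifications converge pointwise under the bound
  \<open>M\<close>, hence in L1 on \<open>K\<close>.\<close>

lemma bounded_variation_L1_Cauchy:
  fixes u :: "nat \<Rightarrow> 'a::euclidean_space \<Rightarrow> real" and \<rho> :: "nat \<Rightarrow> 'a \<Rightarrow> real"
  assumes \<Omega>: "open \<Omega>" "emeasure lborel \<Omega> < \<infinity>"
    and u: "\<And>n. u n \<in> borel_measurable borel" "\<And>n x. \<bar>u n x\<bar> \<le> M" "\<And>n x. x \<notin> \<Omega> \<Longrightarrow> u n x = 0"
      "\<And>n. variation_le \<Omega> (u n) C"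
    and m: "\<And>k. mollifier (1 / real (Suc k)) (\<rho> k) (G k)"
    and conv: "\<And>k x. convergent (\<lambda>n. \<integral>y. u n y * \<rho> k (x - y) \<partial>lborel)"
    and "0 < e"
  shows "\<exists>N. \<forall>i\<ge>N. \<forall>j\<ge>N. (\<integral>x. norm (u i x - u j x) \<partial>lborel) < e"
proof -
  note [measurable] = u(1) mollifier_measurable[OF m] 
  have [measurable]: "\<Omega> \<in> sets borel" using \<Omega> by simp
  have M: "0 \<le> M" using u(2)[of 0 0] by linarith
  have C: "0 \<le> C" by (rule variation_le_nonneg[OF u(4)])
  note ui = bounded_support_integrable(1)[OF \<Omega>(2) \<open>\<Omega> \<in> sets borel\<close> u(1-3)]
  \<comment> \<open>Budget: \<open>e / 4\<close> off \<open>K\<close>, two mollification errors of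
    \<open>e / 8\<close> and two limit errors of \<open>e / 8\<close>, in total at most three
    quarters of \<open>e\<close>. \<open>M + 1\<close> and later \<open>C + 1\<close> avoid division
    by zero.\<close>
  have e1: "0 < e / 8 / (M + 1)" using M \<open>0 < e\<close> by simp
  obtain K where K: "compact K" "K \<subseteq> \<Omega>" "measure lborel (\<Omega> - K) < e / 8 / (M + 1)"
    using compact_subset_measure_diff_less[OF \<Omega> e1] by metis
  have Km[measurable]: "K \<in> sets borel" using K(1) by (rule borel_compact)
  have "M * measure lborel (\<Omega> - K) \<le> (M + 1) * (e / 8 / (M + 1))"
    using M K(3) by (intro mult_mono) auto
  also have "\<dots> = e / 8" using M nonzero_mult_div_cancel_left[of "M + 1" "e / 8"] by simp
  finally have K4: "2 * M * measure lborel (\<Omega> - K) \<le> e / 4" by simp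
  obtain d' where d': "d' > 0" "(\<Union>x\<in>K. cball x d') \<subseteq> \<Omega>"
    using compact_subset_open_imp_cball_epsilon_subset[OF K(1) \<Omega>(1) K(2)] by metis
  define d where "d = d' / 2"
  have d: "d > 0" "(\<Union>x\<in>K. cball x (2 * d)) \<subseteq> \<Omega>" using d' by (auto simp: d_def)
  \<comment> \<open>The scale is fixed before the indices \<open>i\<close> and \<open>j\<close>: it
    depends on \<open>K\<close> through \<open>d\<close>, on \<open>C\<close> and on
    \<open>e\<close> only.\<close>
  have "0 < min d (e / 8 / (C + 1))" using d C \<open>0 < e\<close> by simp
  then obtain k where k: "1 / real (Suc k) < min d (e / 8 / (C + 1))"
    using nat_approx_posE by blast
  define \<tau> where "\<tau> = 1 / real (Suc k)"
  have \<tau>: "0 < \<tau>" "\<tau> \<le> d" "\<tau> < e / 8 / (C + 1)" using k by (auto simp: \<tau>_def)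
  have "\<tau> * C \<le> e / 8 / (C + 1) * (C + 1)"
    using \<tau> C by (intro mult_mono) auto
  also have "\<dots> = e / 8"
    using C by (subst times_divide_eq_left) (rule nonzero_mult_div_cancel_right, simp)
  finally have \<tau>C: "\<tau> * C \<le> e / 8" .
  define v where "v n x = (\<integral>y. u n y * \<rho> k (x - y) \<partial>lborel)" for n x
  define l where "l x = lim (\<lambda>n. v n x)" for x
  have vl: "(\<lambda>n. v n x) \<longlonglongrightarrow> l x" for x
    using conv[of k x] unfolding l_def v_def by (simp add: convergent_LIMSEQ_iff)
  have vc: "continuous_on UNIV (v n)" for n
    unfolding v_def[abs_def] by (rule C1_grad_continuous[OF mollify_C1(1)[OF m ui]])
  then have [measurable]: "v n \<in> borel_measurable borel" for n by (rule borel_measurable_continuous_onI)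
  have [measurable]: "l \<in> borel_measurable borel"
    by (rule borel_measurable_LIMSEQ_real[OF vl]) simp
  have vM: "\<bar>v n x\<bar> \<le> M" for n x
    unfolding v_def using u(2) M by (intro mollify_bound[OF m u(1)])
  have lM: "\<bar>l x\<bar> \<le> M" for x
    using vM by (intro LIMSEQ_le_const2[OF tendsto_rabs[OF vl]]) auto
  have L1: "integrable lborel (\<lambda>x. indicator K x * \<bar>v n x - u n x\<bar>)"
      "(\<integral>x. indicator K x * \<bar>v n x - u n x\<bar> \<partial>lborel) \<le> \<tau> * C" for n
    using mollify_L1_distance[OF m u(4) ui K(1) d(2,1), of k n] \<tau> by (simp_all add: v_def \<tau>_def)
  have Ki: "integrable lborel (\<lambda>x. 2 * M * indicator K x)"
    using emeasure_compact_finite[OF K(1)] by (intro integrable_mult_right) simp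
  have vli: "integrable lborel (\<lambda>x. indicator K x * \<bar>v n x - l x\<bar>)" for n
  proof (rule Bochner_Integration.integrable_bound[OF Ki])
    show "AE x in lborel. norm (indicator K x * \<bar>v n x - l x\<bar>) \<le> norm (2 * M * indicator K x)"
    proof (intro always_eventually allI)
      fix x
      have "\<bar>v n x - l x\<bar> \<le> 2 * M" using vM[of n x] lM[of x] by linarith
      then show "norm (indicator K x * \<bar>v n x - l x\<bar>) \<le> norm (2 * M * indicator K x)"
        by (simp add: indicator_def)
    qed
  qed measurable
  have "(\<lambda>n. \<integral>x. indicator K x * \<bar>v n x - l x\<bar> \<partial>lborel) \<longlonglongrightarrow> (\<integral>x. 0 \<partial>(lborel :: 'a measure))"
  proof (rule integral_dominated_convergence[OF _ _ Ki])
    show "AE x in lborel. (\<lambda>n. indicator K x * \<bar>v n x - l x\<bar>) \<longlonglongrightarrow> 0"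
    proof (intro always_eventually allI)
      fix x
      have "(\<lambda>n. indicator K x * \<bar>v n x - l x\<bar>) \<longlonglongrightarrow> indicator K x * \<bar>l x - l x\<bar>"
        by (intro tendsto_intros vl)
      then show "(\<lambda>n. indicator K x * \<bar>v n x - l x\<bar>) \<longlonglongrightarrow> 0" by simp
    qed
    show "AE x in lborel. norm (indicator K x * \<bar>v n x - l x\<bar>) \<le> 2 * M * indicator K x" for n
    proof (intro always_eventually allI)
      fix x
      have "\<bar>v n x - l x\<bar> \<le> 2 * M" using vM[of n x] lM[of x] by linarith
      then show "norm (indicator K x * \<bar>v n x - l x\<bar>) \<le> 2 * M * indicator K x"
        by (simp add: indicator_def)
    qed
  qed measurable
  then have "\<forall>\<^sub>F n in sequentially. (\<integral>x. indicator K x * \<bar>v n x - l x\<bar> \<partial>lborel) < e / 8"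
    using \<open>0 < e\<close> by (intro order_tendstoD(2)) auto
  then obtain N where N: "\<And>n. n \<ge> N \<Longrightarrow> (\<integral>x. indicator K x * \<bar>v n x - l x\<bar> \<partial>lborel) < e / 8"
    by (auto simp: eventually_sequentially)
  have \<Omega>Ki: "integrable lborel (\<lambda>x. 2 * M * indicator (\<Omega> - K) x)"
    using \<Omega>(2) emeasure_mono[of "\<Omega> - K" \<Omega> lborel] by (intro integrable_mult_right) auto
  show ?thesis
  proof (intro exI[of _ N] allI impI)
    fix i j assume ij: "i \<ge> N" "j \<ge> N"
    have "(\<integral>x. norm (u i x - u j x) \<partial>lborel) \<le> (\<integral>x. 2 * M * indicator (\<Omega> - K) x
        + (indicator K x * \<bar>v i x - u i x\<bar> + indicator K x * \<bar>v j x - u j x\<bar>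
        + (indicator K x * \<bar>v i x - l x\<bar> + indicator K x * \<bar>v j x - l x\<bar>)) \<partial>lborel)"
    proof (rule Bochner_Integration.integral_mono)
      show "integrable lborel (\<lambda>x. norm (u i x - u j x))" using ui by auto
      show "integrable lborel (\<lambda>x. 2 * M * indicator (\<Omega> - K) x
        + (indicator K x * \<bar>v i x - u i x\<bar> + indicator K x * \<bar>v j x - u j x\<bar>
        + (indicator K x * \<bar>v i x - l x\<bar> + indicator K x * \<bar>v j x - l x\<bar>)))"
        by (intro Bochner_Integration.integrable_add \<Omega>Ki L1 vli)
      fix x
      consider "x \<in> K" | "x \<in> \<Omega> - K" | "x \<notin> \<Omega>" by blast
      then show "norm (u i x - u j x) \<le> 2 * M * indicator (\<Omega> - K) x
        + (indicator K x * \<bar>v i x - u i x\<bar> + indicator K x * \<bar>v j x - u j x\<bar>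
        + (indicator K x * \<bar>v i x - l x\<bar> + indicator K x * \<bar>v j x - l x\<bar>))"
      proof cases
        case 1 then show ?thesis by simp
      next
        case 2 then show ?thesis using u(2)[of i x] u(2)[of j x] by simp
      next
        case 3 then show ?thesis using u(3) K(2) by (auto simp: indicator_def)
      qed
    qed
    also have "\<dots> = 2 * M * measure lborel (\<Omega> - K) + ((\<integral>x. indicator K x * \<bar>v i x - u i x\<bar> \<partial>lborel)
        + (\<integral>x. indicator K x * \<bar>v j x - u j x\<bar> \<partial>lborel) + ((\<integral>x. indicator K x * \<bar>v i x - l x\<bar> \<partial>lborel)
        + (\<integral>x. indicator K x * \<bar>v j x - l x\<bar> \<partial>lborel)))"
      using \<Omega>Ki L1(1) vli by (simp del: integrable_mult_right_iff integrable_mult_left_iff)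
    also have "\<dots> < e"
      using K4 L1(2)[of i] L1(2)[of j] N[OF ij(1)] N[OF ij(2)] \<tau>C \<open>0 < e\<close> by linarith
    finally show "(\<integral>x. norm (u i x - u j x) \<partial>lborel) < e" .
  qed
qed

theorem bounded_variation_compactness:
  fixes u :: "nat \<Rightarrow> 'a::euclidean_space \<Rightarrow> real"
  assumes \<Omega>: "open \<Omega>" "emeasure lborel \<Omega> < \<infinity>"
    and u: "\<And>n. u n \<in> borel_measurable borel" "\<And>n x. \<bar>u n x\<bar> \<le> M" "\<And>n x. x \<notin> \<Omega> \<Longrightarrow> u n x = 0"
      "\<And>n. variation_le \<Omega> (u n) C"
  obtains s w where "strict_mono s" "w \<in> borel_measurable borel" "AE x in lborel. (\<lambda>n. u (s n) x) \<longlonglongrightarrow> w x"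
proof -
  have [measurable]: "\<Omega> \<in> sets borel" using \<Omega> by simp
  note [measurable] = u(1)
  have M: "0 \<le> M" using u(2)[of 0 0] by linarith
  note ui = bounded_support_integrable[OF \<Omega>(2) \<open>\<Omega> \<in> sets borel\<close> u(1-3)]
  have "\<exists>\<rho> G. mollifier (1 / real (Suc k)) \<rho> (G :: 'a \<Rightarrow> 'a)" for k
    using mollifier_exists[of "1 / real (Suc k)"] by (metis of_nat_0_less_iff zero_less_Suc zero_less_divide_1_iff)
  then obtain \<rho> :: "nat \<Rightarrow> 'a \<Rightarrow> real" and G where m: "\<And>k. mollifier (1 / real (Suc k)) (\<rho> k) (G k)" by metis
  obtain D :: "'a set" where D: "countable D" "\<And>X. open X \<Longrightarrow> X \<noteq> {} \<Longrightarrow> \<exists>q\<in>D. q \<in> X"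
    using countable_dense_exists by blast
  \<comment> \<open>Indexing by pairs of a scale and a dense point lets a single extraction serve
    all scales; boundedness by \<open>M\<close> is all that it requires.\<close>
  let ?f = "\<lambda>n z. \<integral>y. u n y * \<rho> (fst z) (snd z - y) \<partial>lborel"
  have cnt: "countable ((UNIV :: nat set) \<times> D)" using D(1) by simp
  have bd: "norm (?f n z) \<le> M" for n z
    using u(2) M by (simp, intro mollify_bound[OF m u(1)])
  have "\<exists>s::nat \<Rightarrow> nat. strict_mono s \<and> (\<forall>z\<in>(UNIV :: nat set) \<times> D. convergent (\<lambda>n. ?f (s n) z))"
    by (rule function_convergent_subsequence[where f="?f" and M=M, OF cnt bd]) (auto simp: convergent_def)
  then obtain s where s: "strict_mono (s :: nat \<Rightarrow> nat)"
      "\<And>k q. q \<in> D \<Longrightarrow> convergent (\<lambda>n. \<integral>y. u (s n) y * \<rho> k (q - y) \<partial>lborel)"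
    by fastforce
  have conv: "convergent (\<lambda>n. \<integral>y. u (s n) y * \<rho> k (x - y) \<partial>lborel)" for k x
    by (rule mollified_convergence_everywhere[OF m ui D(2) s(2)])
  \<comment> \<open>A second extraction: a sequence that is Cauchy in L1 has a subsequence that is
    Cauchy almost everywhere.\<close>
  obtain r where r: "strict_mono r" "AE x in lborel. Cauchy (\<lambda>i. u (s (r i)) x)"
    using cauchy_L1_AE_cauchy_subseq[of lborel "\<lambda>n. u (s n)"] ui(1)
      bounded_variation_L1_Cauchy[OF \<Omega> u m conv] by metis
  show thesis
  proof (rule that)
    show "strict_mono (s \<circ> r)" using s(1) r(1) by (rule strict_mono_o)
    \<comment> \<open>Where the sequence diverges, \<open>lim\<close> is an unspecified value; the
      limit function is measurable all the same.\<close>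
    show "(\<lambda>x. lim (\<lambda>i. u (s (r i)) x)) \<in> borel_measurable borel" by measurable
    show "AE x in lborel. (\<lambda>n. u ((s \<circ> r) n) x) \<longlonglongrightarrow> lim (\<lambda>i. u (s (r i)) x)"
      using r(2) by eventually_elim (simp add: Cauchy_convergent_iff convergent_LIMSEQ_iff)
  qed
qed

section \<open>Existence of minimizers\<close>

lemma AE_lborel_imp_lebesgue_on:
  assumes "AE x in lborel. P x" "\<Omega> \<in> sets lebesgue"
  shows "AE x in lebesgue_on \<Omega>. P x"
proof -
  have "AE x in lebesgue. P x" using assms(1) by (rule AE_completion)
  then have "AE x in lebesgue. x \<in> \<Omega> \<longrightarrow> P x" by eventually_elim simp
  then show ?thesis using assms(2) by (simp add: AE_restrict_space_iff)
qed

lemma borel_measurable_lebesgue_on_of_borel: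
  fixes u :: "'a::euclidean_space \<Rightarrow> real"
  shows "u \<in> borel_measurable borel \<Longrightarrow> u \<in> borel_measurable (lebesgue_on \<Omega>)"
  by (intro measurable_restrict_space1 measurable_completion) simp

lemma finite_measure_lebesgue_on_open:
  "open \<Omega> \<Longrightarrow> emeasure lebesgue \<Omega> < \<infinity> \<Longrightarrow> finite_measure (lebesgue_on \<Omega>)"
  by (rule finite_measureI) (simp add: emeasure_restrict_space)

text \<open>The convolution estimates concern Borel functions on the whole space. The zero extension
  agrees almost everywhere with a Borel function, and multiplying by the indicator of \<Omega> makes
  the zeros outside exact again.\<close>

lemma borel_representative:
  fixes w :: "'a::euclidean_space \<Rightarrow> real"
  assumes \<Omega>: "open \<Omega>" and w: "w \<in> borel_measurable (lebesgue_on \<Omega>)"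
  obtains u where "u \<in> borel_measurable borel" "\<And>x. x \<notin> \<Omega> \<Longrightarrow> u x = 0" "AE x in lebesgue_on \<Omega>. u x = w x"
proof -
  have S: "\<Omega> \<in> sets lebesgue" using \<Omega> by simp
  have "(\<lambda>x. if x \<in> \<Omega> then w x else 0) \<in> borel_measurable lebesgue"
    using w S by (simp add: borel_measurable_if)
  then obtain g where g: "g \<in> borel_measurable lborel" "AE x in lborel. (if x \<in> \<Omega> then w x else 0) = g x"
    using completion_ex_borel_measurable_real by blast
  have "AE x in lebesgue. (if x \<in> \<Omega> then w x else 0) = g x" using g(2) by (rule AE_completion)
  then have "AE x in lebesgue. x \<in> \<Omega> \<longrightarrow> indicator \<Omega> x * g x = w x" by eventually_elim auto
  then have "AE x in lebesgue_on \<Omega>. indicator \<Omega> x * g x = w x" using S by (simp add: AE_restrict_space_iff)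
  moreover have "(\<lambda>x. indicator \<Omega> x * g x) \<in> borel_measurable borel" using g(1) \<Omega> by simp
  ultimately show thesis by (intro that) auto
qed

lemma integral_lebesgue_on_divergence:
  fixes u w :: "'a::euclidean_space \<Rightarrow> real"
  assumes \<Omega>: "open \<Omega>" and u: "u \<in> borel_measurable borel" and w: "w \<in> borel_measurable (lebesgue_on \<Omega>)"
    and eq: "AE x in lebesgue_on \<Omega>. u x = w x" and \<phi>: "\<phi> \<in> C1_compactly_supported \<Omega>"
  shows "(\<integral>x. w x * divergence \<phi> x \<partial>lebesgue_on \<Omega>) = (\<integral>x. u x * divergence \<phi> x \<partial>lborel)"
proof -
  obtain K where K: "K \<subseteq> \<Omega>" and div: "continuous_on UNIV (divergence \<phi>)" "\<And>x. x \<notin> K \<Longrightarrow> divergence \<phi> x = 0"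
    using C1_compactly_supportedE[OF \<phi>] by blast
  have S: "\<Omega> \<in> sets lebesgue" using \<Omega> by simp
  have d: "divergence \<phi> \<in> borel_measurable borel" by (rule borel_measurable_continuous_onI[OF div(1)])
  note [measurable] = borel_measurable_lebesgue_on_of_borel[OF d] borel_measurable_lebesgue_on_of_borel[OF u] w
  have "(\<integral>x. w x * divergence \<phi> x \<partial>lebesgue_on \<Omega>) = (\<integral>x. u x * divergence \<phi> x \<partial>lebesgue_on \<Omega>)"
    by (rule integral_cong_AE) (use eq in auto)
  also have "\<dots> = (\<integral>x. indicator \<Omega> x *\<^sub>R (u x * divergence \<phi> x) \<partial>lebesgue)"
    using S by (intro integral_restrict_space) simp
  also have "(\<lambda>x. indicator \<Omega> x *\<^sub>R (u x * divergence \<phi> x)) = (\<lambda>x. u x * divergence \<phi> x)"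
    using div(2) K by (force simp: indicator_def)
  also have "(\<integral>x. u x * divergence \<phi> x \<partial>lebesgue) = (\<integral>x. u x * divergence \<phi> x \<partial>lborel)"
    using u d by (intro integral_completion) simp
  finally show ?thesis .
qed

text \<open>\<open>TV\<close> compares pairings after truncation by \<open>ennreal\<close>,
  \<open>variation_le\<close> compares real numbers; for \<open>0 \<le> C\<close> the two
  agree.\<close>

lemma TV_le_iff:
  fixes u w :: "'a::euclidean_space \<Rightarrow> real"
  assumes \<Omega>: "open \<Omega>" and u: "u \<in> borel_measurable borel" and w: "w \<in> borel_measurable (lebesgue_on \<Omega>)"
    and eq: "AE x in lebesgue_on \<Omega>. u x = w x" and C: "0 \<le> C"
  shows "TV \<Omega> w \<le> ennreal C \<longleftrightarrow> variation_le \<Omega> u C"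
  unfolding TV_def variation_le_def SUP_le_iff
  using integral_lebesgue_on_divergence[OF \<Omega> u w eq] C by (auto simp: ennreal_le_iff)

section \<open>Lower semicontinuity of the energy\<close>

lemma liminf_add_le_ennreal:
  fixes f g :: "nat \<Rightarrow> ennreal"
  shows "liminf f + liminf g \<le> liminf (\<lambda>n. f n + g n)"
proof -
  have "incseq (\<lambda>n. INF m\<in>{n..}. f m)" "incseq (\<lambda>n. INF m\<in>{n..}. g m)"
    by (auto simp: incseq_def intro!: INF_superset_mono)
  then have "liminf f + liminf g = (SUP n. (INF m\<in>{n..}. f m) + (INF m\<in>{n..}. g m))"
    unfolding liminf_SUP_INF by (rule ennreal_SUP_add[symmetric])
  also have "\<dots> \<le> liminf (\<lambda>n. f n + g n)"
    unfolding liminf_SUP_INF by (intro SUP_mono bexI INF_greatest add_mono INF_lower) auto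
  finally show ?thesis .
qed

text \<open>A supremum of functionals that are continuous along the sequence is lower
  semicontinuous. Continuity for one field is dominated convergence with a constant majorant,
  integrable because \<Omega> has finite measure.\<close>

lemma TV_lower_semicontinuous:
  fixes u :: "nat \<Rightarrow> 'a::euclidean_space \<Rightarrow> real"
  assumes \<Omega>: "open \<Omega>" "emeasure lebesgue \<Omega> < \<infinity>"
    and u: "\<And>n. u n \<in> borel_measurable (lebesgue_on \<Omega>)" "w \<in> borel_measurable (lebesgue_on \<Omega>)"
    and M: "\<And>n. AE x in lebesgue_on \<Omega>. \<bar>u n x\<bar> \<le> M"
    and lim: "AE x in lebesgue_on \<Omega>. (\<lambda>n. u n x) \<longlonglongrightarrow> w x"
  shows "TV \<Omega> w \<le> liminf (\<lambda>n. TV \<Omega> (u n))"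
  unfolding TV_def[of \<Omega> w]
proof (rule SUP_least)
  fix \<phi> :: "'a \<Rightarrow> 'a" assume \<phi>: "\<phi> \<in> {\<phi> \<in> C1_compactly_supported \<Omega>. \<forall>x. norm (\<phi> x) \<le> 1}"
  then obtain K where K: "compact K" and div: "continuous_on UNIV (divergence \<phi>)" "\<And>x. x \<notin> K \<Longrightarrow> divergence \<phi> x = 0"
    using C1_compactly_supportedE[of \<phi> \<Omega>] by blast
  obtain B where B: "\<And>x. norm (divergence \<phi> x) \<le> B"
    using bounded_continuous_compact_support[OF div(1) K div(2)] by metis
  have d: "divergence \<phi> \<in> borel_measurable borel" by (rule borel_measurable_continuous_onI[OF div(1)])
  note [measurable] = u borel_measurable_lebesgue_on_of_borel[OF d]
  have "(\<lambda>n. \<integral>x. u n x * divergence \<phi> x \<partial>lebesgue_on \<Omega>) \<longlonglongrightarrow> (\<integral>x. w x * divergence \<phi> x \<partial>lebesgue_on \<Omega>)"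
  proof (rule integral_dominated_convergence[where w="\<lambda>_. \<bar>M\<bar> * B"])
    show "integrable (lebesgue_on \<Omega>) (\<lambda>_. \<bar>M\<bar> * B)"
      by (rule finite_measure.integrable_const[OF finite_measure_lebesgue_on_open[OF \<Omega>]])
    show "AE x in lebesgue_on \<Omega>. (\<lambda>n. u n x * divergence \<phi> x) \<longlonglongrightarrow> w x * divergence \<phi> x"
      using lim by eventually_elim (intro tendsto_intros)
    show "AE x in lebesgue_on \<Omega>. norm (u n x * divergence \<phi> x) \<le> \<bar>M\<bar> * B" for n
      using M[of n]
    proof eventually_elim
      case (elim x)
      then show ?case using B[of x] by (auto simp: abs_mult intro!: mult_mono)
    qed
  qed measurable
  then have "(\<lambda>n. ennreal (\<integral>x. u n x * divergence \<phi> x \<partial>lebesgue_on \<Omega>)) \<longlonglongrightarrow>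
      ennreal (\<integral>x. w x * divergence \<phi> x \<partial>lebesgue_on \<Omega>)" by (rule tendsto_ennrealI)
  then have "ennreal (\<integral>x. w x * divergence \<phi> x \<partial>lebesgue_on \<Omega>)
      = liminf (\<lambda>n. ennreal (\<integral>x. u n x * divergence \<phi> x \<partial>lebesgue_on \<Omega>))"
    by (intro lim_imp_Liminf[symmetric]) auto
  also have "\<dots> \<le> liminf (\<lambda>n. TV \<Omega> (u n))"
    unfolding TV_def using \<phi> by (intro Liminf_mono always_eventually allI SUP_upper)
  finally show "ennreal (\<integral>x. w x * divergence \<phi> x \<partial>lebesgue_on \<Omega>) \<le> liminf (\<lambda>n. TV \<Omega> (u n))" .
qed

lemma log_energy_lower_semicontinuous:
  fixes u :: "nat \<Rightarrow> 'a::euclidean_space \<Rightarrow> real"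
  assumes \<Omega>: "open \<Omega>" "emeasure lebesgue \<Omega> < \<infinity>"
    and u: "\<And>n. u n \<in> borel_measurable (lebesgue_on \<Omega>)" "w \<in> borel_measurable (lebesgue_on \<Omega>)"
    and f: "f \<in> borel_measurable (lebesgue_on \<Omega>)"
    and M: "\<And>n. AE x in lebesgue_on \<Omega>. \<bar>u n x\<bar> \<le> M"
    and lim: "AE x in lebesgue_on \<Omega>. (\<lambda>n. u n x) \<longlonglongrightarrow> w x"
  shows "log_energy \<Omega> l f w \<le> liminf (\<lambda>n. log_energy \<Omega> l f (u n))"
proof -
  note [measurable] = u f
  \<comment> \<open>With the factor inside the integral, Fatou's lemma bounds the weighted data term
    directly.\<close>
  let ?F = "\<lambda>v x. ennreal l * ennreal ((f x * exp (- v x) - 1)\<^sup>2)"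
  have F: "ennreal l * (\<integral>\<^sup>+x. ennreal ((f x * exp (- v x) - 1)\<^sup>2) \<partial>lebesgue_on \<Omega>) = (\<integral>\<^sup>+x. ?F v x \<partial>lebesgue_on \<Omega>)"
    if [measurable]: "v \<in> borel_measurable (lebesgue_on \<Omega>)" for v
    by (rule nn_integral_cmult[symmetric]) measurable
  have "(\<integral>\<^sup>+x. ?F w x \<partial>lebesgue_on \<Omega>) = (\<integral>\<^sup>+x. liminf (\<lambda>n. ?F (u n) x) \<partial>lebesgue_on \<Omega>)"
  proof (rule nn_integral_cong_AE)
    show "AE x in lebesgue_on \<Omega>. ?F w x = liminf (\<lambda>n. ?F (u n) x)"
      using lim
    proof eventually_elim
      case (elim x)
      have "(\<lambda>n. ?F (u n) x) \<longlonglongrightarrow> ?F w x"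
        by (intro ennreal_tendsto_cmult tendsto_ennrealI tendsto_intros elim) simp
      then show ?case by (intro lim_imp_Liminf[symmetric]) auto
    qed
  qed
  also have "\<dots> \<le> liminf (\<lambda>n. \<integral>\<^sup>+x. ?F (u n) x \<partial>lebesgue_on \<Omega>)"
    by (rule nn_integral_liminf) measurable
  finally have "log_energy \<Omega> l f w \<le> liminf (\<lambda>n. \<integral>\<^sup>+x. ?F (u n) x \<partial>lebesgue_on \<Omega>) + liminf (\<lambda>n. TV \<Omega> (u n))"
    unfolding log_energy_def F[OF u(2)] by (intro add_mono TV_lower_semicontinuous[OF \<Omega> u M lim])
  also have "\<dots> \<le> liminf (\<lambda>n. log_energy \<Omega> l f (u n))"
    unfolding log_energy_def F[OF u(1)] by (rule liminf_add_le_ennreal)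
  finally show ?thesis .
qed

section \<open>Truncation and the energy\<close>

text \<open>As a function of \<open>w\<close>, \<open>y * exp (- w)\<close> decreases and equals 1
  at \<open>w = ln y\<close>, so the deviation from 1 grows on either side of \<open>ln y\<close>.
  Clamping to an interval containing \<open>ln y\<close> moves \<open>w\<close> towards that point
  without passing it.\<close>

lemma clamp_data_term_le:
  fixes y :: real
  assumes "0 < y" "a \<le> ln y" "ln y \<le> b"
  shows "(y * exp (- min b (max a w)) - 1)\<^sup>2 \<le> (y * exp (- w) - 1)\<^sup>2"
proof -
  have y: "y * exp (- s) = exp (ln y - s)" for s using assms(1) by (simp add: exp_diff exp_minus field_simps)
  have "\<bar>exp (ln y - min b (max a w)) - 1\<bar> \<le> \<bar>exp (ln y - w) - 1\<bar>"
  proof (cases "w \<le> ln y")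
    case True
    then have "w \<le> min b (max a w)" "min b (max a w) \<le> ln y" using assms by auto
    then have "1 \<le> exp (ln y - min b (max a w))" "exp (ln y - min b (max a w)) \<le> exp (ln y - w)" by auto
    then show ?thesis by linarith
  next
    case False
    then have "min b (max a w) \<le> w" "ln y \<le> min b (max a w)" using assms by auto
    then have "exp (ln y - min b (max a w)) \<le> 1" "exp (ln y - w) \<le> exp (ln y - min b (max a w))" by auto
    then show ?thesis by linarith
  qed
  then show ?thesis unfolding y by (simp add: abs_le_square_iff)
qed

lemma log_energy_clamp_le:
  fixes v :: "'a::euclidean_space \<Rightarrow> real"
  assumes \<Omega>: "open \<Omega>" and v: "v \<in> BV \<Omega>"
    and f: "AE x in lebesgue_on \<Omega>. 0 < f x \<and> a \<le> ln (f x) \<and> ln (f x) \<le> b"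
  obtains u where "u \<in> borel_measurable borel" "\<And>x. x \<notin> \<Omega> \<Longrightarrow> u x = 0"
    "\<And>x. x \<in> \<Omega> \<Longrightarrow> u x = min b (max a (u x))" "log_energy \<Omega> l f u \<le> log_energy \<Omega> l f v"
proof -
  have S: "\<Omega> \<in> sets lebesgue" using \<Omega> by simp
  have vi: "integrable (lebesgue_on \<Omega>) v" and vTV: "TV \<Omega> v < \<infinity>" using v by (auto simp: BV_def)
  have vm: "v \<in> borel_measurable (lebesgue_on \<Omega>)" by (rule borel_measurable_integrable[OF vi])
  obtain w where w: "w \<in> borel_measurable borel" "\<And>x. x \<notin> \<Omega> \<Longrightarrow> w x = 0" "AE x in lebesgue_on \<Omega>. w x = v x"
    using borel_representative[OF \<Omega> vm] by metis
  have "integrable (lebesgue_on \<Omega>) w"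
    using integrable_cong_AE[of w "lebesgue_on \<Omega>" v] w(1,3) vm vi borel_measurable_lebesgue_on_of_borel by metis
  then have "integrable lebesgue (\<lambda>x. indicator \<Omega> x *\<^sub>R w x)"
    using S by (subst (asm) integrable_restrict_space) auto
  also have "(\<lambda>x. indicator \<Omega> x *\<^sub>R w x) = w"
  proof
    show "indicator \<Omega> x *\<^sub>R w x = w x" for x using w(2)[of x] by (cases "x \<in> \<Omega>") auto
  qed
  finally have wi: "integrable lborel w" using w(1) by (simp add: integrable_completion)
  define C where "C = enn2real (TV \<Omega> v)"
  have C: "TV \<Omega> v = ennreal C" "0 \<le> C" using vTV by (auto simp: C_def)
  have "variation_le \<Omega> w C"
    using TV_le_iff[OF \<Omega> w(1) vm w(3) C(2)] C(1) by simp
  then have vc: "variation_le \<Omega> (\<lambda>x. min b (max a (w x))) C" by (rule variation_le_clamp[OF \<Omega> _ wi])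
  \<comment> \<open>If 0 is outside the range, the clamp alone is nonzero off \<Omega>; the
    indicator restores the zero extension that the compactness theorem expects. Values off \<Omega>
    do not affect the variation, so the bound for the unrestricted clamp carries over.\<close>
  define u where "u x = indicator \<Omega> x * min b (max a (w x))" for x
  have um: "u \<in> borel_measurable borel" using w(1) \<Omega> unfolding u_def[abs_def] by simp
  have "TV \<Omega> u \<le> ennreal C"
  proof (rule TV_le_iff[OF \<Omega> _ _ _ C(2), THEN iffD2, OF _ _ _ vc])
    show "(\<lambda>x. min b (max a (w x))) \<in> borel_measurable borel" using w(1) by simp
    show "u \<in> borel_measurable (lebesgue_on \<Omega>)" by (rule borel_measurable_lebesgue_on_of_borel[OF um])
    show "AE x in lebesgue_on \<Omega>. min b (max a (w x)) = u x"
      by (rule AE_I2) (simp add: u_def)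
  qed
  moreover have "(\<integral>\<^sup>+x. ennreal ((f x * exp (- u x) - 1)\<^sup>2) \<partial>lebesgue_on \<Omega>)
      \<le> (\<integral>\<^sup>+x. ennreal ((f x * exp (- v x) - 1)\<^sup>2) \<partial>lebesgue_on \<Omega>)"
  proof (rule nn_integral_mono_AE)
    show "AE x in lebesgue_on \<Omega>. ennreal ((f x * exp (- u x) - 1)\<^sup>2) \<le> ennreal ((f x * exp (- v x) - 1)\<^sup>2)"
      using f w(3) AE_space
    proof eventually_elim
      case (elim x)
      then have "u x = min b (max a (v x))" by (simp add: u_def)
      then show ?case using clamp_data_term_le[of "f x" a b "v x"] elim by (simp add: ennreal_leI)
    qed
  qed
  ultimately have "log_energy \<Omega> l f u \<le> log_energy \<Omega> l f v"
    unfolding log_energy_def C(1) by (intro add_mono mult_left_mono) auto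
  then show thesis by (intro that[of u] um) (auto simp: u_def)
qed

section \<open>The direct method\<close>

theorem log_energy_minimizer_exists:
  fixes \<Omega> :: "'a::euclidean_space set"
  assumes \<Omega>: "open \<Omega>" "emeasure lebesgue \<Omega> < \<infinity>"
    and fm: "f \<in> borel_measurable (lebesgue_on \<Omega>)"
    and f: "AE x in lebesgue_on \<Omega>. 0 < f x \<and> a \<le> ln (f x) \<and> ln (f x) \<le> b" and ab: "a \<le> b"
  shows "\<exists>w. is_arg_min (log_energy \<Omega> l f) (\<lambda>v. v \<in> BV \<Omega>) w \<and> (\<forall>x. a \<le> w x \<and> w x \<le> b)"
proof -
  have S: "\<Omega> \<in> sets lebesgue" using \<Omega> by simp
  have \<Omega>': "emeasure lborel \<Omega> < \<infinity>" using \<Omega> by simp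
  have fin: "emeasure (lebesgue_on \<Omega>) (space (lebesgue_on \<Omega>)) < \<infinity>"
    using \<Omega> by (simp add: emeasure_restrict_space)
  define I where "I = (INF v\<in>BV \<Omega>. log_energy \<Omega> l f v)"
  have "TV \<Omega> (\<lambda>_. 0) \<le> 0" unfolding TV_def by (rule SUP_least) simp
  then have TV0: "TV \<Omega> (\<lambda>_. 0) = 0" by simp
  have BV0: "(\<lambda>_. 0) \<in> BV \<Omega>" by (simp add: BV_def TV0)
  \<comment> \<open>The zero function is a competitor of finite energy, since \<open>f\<close> is at
    most \<open>exp b\<close> and \<Omega> has finite measure. A finite infimum is what bounds the
    variation of the minimizing sequence.\<close>
  have "(\<integral>\<^sup>+x. ennreal ((f x * exp (- 0) - 1)\<^sup>2) \<partial>lebesgue_on \<Omega>) \<le> (\<integral>\<^sup>+x. ennreal ((exp b + 1)\<^sup>2) \<partial>lebesgue_on \<Omega>)"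
  proof (rule nn_integral_mono_AE)
    show "AE x in lebesgue_on \<Omega>. ennreal ((f x * exp (- 0) - 1)\<^sup>2) \<le> ennreal ((exp b + 1)\<^sup>2)"
      using f
    proof eventually_elim
      case (elim x)
      then have "f x \<le> exp b" by (metis exp_le_cancel_iff exp_ln)
      then have "\<bar>f x - 1\<bar> \<le> \<bar>exp b + 1\<bar>" using elim by auto
      then have "(f x - 1)\<^sup>2 \<le> (exp b + 1)\<^sup>2" by (rule abs_le_square_iff[THEN iffD1])
      then show ?case by (simp add: ennreal_leI)
    qed
  qed
  also have "\<dots> < \<infinity>" using fin by (simp add: ennreal_mult_less_top)
  finally have "log_energy \<Omega> l f (\<lambda>_. 0) < \<infinity>"
    by (simp add: log_energy_def TV0 ennreal_mult_less_top)
  then have Ifin: "I < \<infinity>" unfolding I_def using BV0 by (meson INF_lower le_less_trans)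
  have "\<exists>u. u \<in> borel_measurable borel \<and> (\<forall>x. x \<notin> \<Omega> \<longrightarrow> u x = 0) \<and> (\<forall>x\<in>\<Omega>. u x = min b (max a (u x))) \<and>
      log_energy \<Omega> l f u \<le> I + ennreal (1 / real (Suc n))" for n
  proof -
    obtain r where r: "I = ennreal r" "0 \<le> r" using Ifin by (cases I) auto
    then have "I < I + ennreal (1 / real (Suc n))"
      by (simp add: ennreal_plus[symmetric] ennreal_less_iff del: ennreal_plus)
    then have "(INF v\<in>BV \<Omega>. log_energy \<Omega> l f v) < I + ennreal (1 / real (Suc n))"
      by (simp only: I_def)
    then obtain v where v: "v \<in> BV \<Omega>" "log_energy \<Omega> l f v < I + ennreal (1 / real (Suc n))"
      unfolding INF_less_iff by blast
    obtain u where "u \<in> borel_measurable borel" "\<And>x. x \<notin> \<Omega> \<Longrightarrow> u x = 0"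
      "\<And>x. x \<in> \<Omega> \<Longrightarrow> u x = min b (max a (u x))" "log_energy \<Omega> l f u \<le> log_energy \<Omega> l f v"
      using log_energy_clamp_le[OF \<Omega>(1) v(1) f] by metis
    then show ?thesis using v(2) by (intro exI[of _ u]) auto
  qed
  then obtain u where u: "\<And>n. u n \<in> borel_measurable borel" "\<And>n x. x \<notin> \<Omega> \<Longrightarrow> u n x = 0"
    "\<And>n x. x \<in> \<Omega> \<Longrightarrow> u n x = min b (max a (u n x))" "\<And>n. log_energy \<Omega> l f (u n) \<le> I + ennreal (1 / real (Suc n))"
    by metis
  have um: "u n \<in> borel_measurable (lebesgue_on \<Omega>)" for n by (rule borel_measurable_lebesgue_on_of_borel[OF u(1)])
  define M where "M = \<bar>a\<bar> + \<bar>b\<bar>"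
  have uM: "\<bar>u n x\<bar> \<le> M" for n x
    using u(2)[of x n] u(3)[of x n] by (cases "x \<in> \<Omega>") (auto simp: M_def min_def max_def abs_if split: if_splits)
  \<comment> \<open>The excess \<open>1 / real (Suc n)\<close> over the infimum never exceeds
    1.\<close>
  define C where "C = enn2real (I + 1)"
  have C: "I + 1 = ennreal C" "0 \<le> C" using Ifin by (auto simp: C_def less_top)
  have vl: "variation_le \<Omega> (u n) C" for n
  proof -
    have "TV \<Omega> (u n) \<le> log_energy \<Omega> l f (u n)" by (simp add: log_energy_def)
    also have "\<dots> \<le> I + ennreal (1 / real (Suc n))" by (rule u(4))
    also have "\<dots> \<le> I + 1" by (intro add_mono) (auto simp: ennreal_le_1)
    finally show ?thesis using TV_le_iff[OF \<Omega>(1) u(1)[of n] um[of n] _ C(2)] C(1) by simp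
  qed
  obtain s w where sw: "strict_mono s" "w \<in> borel_measurable borel" "AE x in lborel. (\<lambda>n. u (s n) x) \<longlonglongrightarrow> w x"
    by (rule bounded_variation_compactness[OF \<Omega>(1) \<Omega>' u(1) uM u(2) vl])
  \<comment> \<open>The limit lies in the range only almost everywhere on \<Omega>; clamping it
    gives the bounds at every point. Since each \<open>u n\<close> is fixed by the clamp on \<Omega>
    and the clamp is continuous, the sequence still converges to the clamped limit there.\<close>
  define w' where "w' x = min b (max a (w x))" for x
  have w'b: "a \<le> w' x" "w' x \<le> b" for x using ab by (auto simp: w'_def)
  have "w' \<in> borel_measurable borel" using sw(2) unfolding w'_def[abs_def] by simp
  then have w'm: "w' \<in> borel_measurable (lebesgue_on \<Omega>)" by (rule borel_measurable_lebesgue_on_of_borel)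
  have lim: "AE x in lebesgue_on \<Omega>. (\<lambda>n. u (s n) x) \<longlonglongrightarrow> w' x"
    using AE_lborel_imp_lebesgue_on[OF sw(3) S] AE_space
  proof eventually_elim
    case (elim x)
    then have "(\<lambda>n. min b (max a (u (s n) x))) \<longlonglongrightarrow> w' x"
      unfolding w'_def by (intro tendsto_intros) auto
    then show ?case using u(3)[of x] elim by simp
  qed
  have "log_energy \<Omega> l f w' \<le> liminf (\<lambda>n. log_energy \<Omega> l f (u (s n)))"
    using uM by (intro log_energy_lower_semicontinuous[OF \<Omega> um w'm fm _ lim, of M]) auto
  also have "\<dots> \<le> liminf (\<lambda>n. I + ennreal (1 / real (Suc n)))"
  proof (intro Liminf_mono always_eventually allI)
    fix n
    have "1 / real (Suc (s n)) \<le> 1 / real (Suc n)"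
      using seq_suble[OF sw(1), of n] by (intro divide_left_mono) auto
    then show "log_energy \<Omega> l f (u (s n)) \<le> I + ennreal (1 / real (Suc n))"
      by (intro order_trans[OF u(4)] add_left_mono ennreal_leI)
  qed
  also have "\<dots> = I"
  proof (rule lim_imp_Liminf)
    have "(\<lambda>n. I + ennreal (1 / real (Suc n))) \<longlonglongrightarrow> I + ennreal 0"
      by (intro tendsto_add tendsto_const tendsto_ennrealI LIMSEQ_Suc[OF lim_1_over_n])
    then show "(\<lambda>n. I + ennreal (1 / real (Suc n))) \<longlonglongrightarrow> I" by simp
  qed simp
  finally have le: "log_energy \<Omega> l f w' \<le> I" .
  have "TV \<Omega> w' \<le> log_energy \<Omega> l f w'" by (simp add: log_energy_def)
  then have "TV \<Omega> w' < \<infinity>" using le Ifin by (metis le_less_trans)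
  moreover have "integrable (lebesgue_on \<Omega>) w'"
  proof (rule Bochner_Integration.integrable_bound[OF _ w'm])
    show "integrable (lebesgue_on \<Omega>) (\<lambda>_. M)"
      by (rule finite_measure.integrable_const[OF finite_measure_lebesgue_on_open[OF \<Omega>]])
    show "AE x in lebesgue_on \<Omega>. norm (w' x) \<le> norm M"
      using w'b by (intro always_eventually allI) (smt (verit) M_def real_norm_def)
  qed
  ultimately have "w' \<in> BV \<Omega>" by (simp add: BV_def)
  moreover have "I \<le> log_energy \<Omega> l f v" if "v \<in> BV \<Omega>" for v
    unfolding I_def using that by (rule INF_lower)
  ultimately have "is_arg_min (log_energy \<Omega> l f) (\<lambda>v. v \<in> BV \<Omega>) w'"
    using le unfolding is_arg_min_def by (meson leD order_trans)
  then show ?thesis using w'b by blast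
qed

section \<open>Essential bounds of the logarithm of the data\<close>

text \<open>Dual to the bound by \<open>esssup\<close> through negation; in the non-measurable case
  the default value \<open>bot\<close> is below everything.\<close>

lemma AE_essinf_le:
  fixes g :: "'a \<Rightarrow> ereal"
  shows "AE x in M. essinf M g \<le> g x"
proof (cases "g \<in> borel_measurable M")
  case True
  then have "essinf M g = - esssup M (\<lambda>x. - g x)"
    by (simp add: essinf_def esssup_def ereal_Limsup_uminus)
  with esssup_AE[of "\<lambda>x. - g x" M] show ?thesis
    by (auto elim!: eventually_mono simp: ereal_uminus_le_reorder)
qed (simp add: essinf_def bot_ereal_def)

theorem proposition3p2:
  fixes \<Omega> :: "(real ^ 2) set" and f :: "real ^ 2 \<Rightarrow> real" and l\<^sub>0 :: real
  assumes "open \<Omega>" and "connected \<Omega>" and "\<Omega> \<noteq> {}"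
    and "emeasure lebesgue \<Omega> < \<infinity>"
    and "l\<^sub>0 > 0"
    and "f \<in> L_infinity (lebesgue_on \<Omega>)"
    and "essinf (lebesgue_on \<Omega>) (\<lambda>x. ereal (f x)) > 0"
  shows "\<exists>w. is_arg_min (log_energy \<Omega> l\<^sub>0 f) (\<lambda>v. v \<in> BV \<Omega>) w \<and>
    (AE x in lebesgue_on \<Omega>.
       essinf (lebesgue_on \<Omega>) (\<lambda>x. ereal (ln (f x))) \<le> ereal (w x) \<and>
       ereal (w x) \<le> esssup (lebesgue_on \<Omega>) (\<lambda>x. ereal (ln (f x))))"
proof -
  let ?L = "lebesgue_on \<Omega>" and ?g = "\<lambda>x. ereal (ln (f x))"
  have fm[measurable]: "f \<in> borel_measurable ?L" using assms(6) by (simp add: L_infinity_def)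
  have gm: "?g \<in> borel_measurable ?L" by measurable
  have "\<not> negligible \<Omega>" using open_not_negligible[OF assms(1,3)] .
  \<comment> \<open>A nonempty open set has positive measure. On a null set the essential infimum
    would be \<open>\<infinity>\<close> and the supremum \<open>-\<infinity>\<close>, in the wrong
    order.\<close>
  then have nb: "ae_filter ?L \<noteq> bot"
    using assms(1) by (simp add: ae_filter_eq_bot_iff emeasure_restrict_space negligible_iff_emeasure0)
  \<comment> \<open>A positive real lower bound is required because \<open>ln\<close> is monotone
    only on positive arguments; it makes \<open>ln c\<close> a finite lower bound for
    \<open>ln (f x)\<close>.\<close>
  obtain c where c: "0 < ereal c" "ereal c < essinf ?L (\<lambda>x. ereal (f x))"
    using ereal_dense2[OF assms(7)] by (auto simp: zero_ereal_def)
  have cf: "AE x in ?L. c \<le> f x"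
    using AE_essinf_le[of ?L "\<lambda>x. ereal (f x)"]
  proof eventually_elim
    case (elim x)
    with c(2) have "ereal c < ereal (f x)" by (rule less_le_trans)
    then show ?case by simp
  qed
  have "esssup ?L (\<lambda>x. ereal \<bar>f x\<bar>) \<noteq> \<infinity>" using assms(6) by (simp add: L_infinity_def)
  then obtain M :: real where M: "esssup ?L (\<lambda>x. ereal \<bar>f x\<bar>) < ereal M"
    unfolding less_PInf_Ex_of_nat by blast
  have fM: "AE x in ?L. \<bar>f x\<bar> \<le> M"
    using esssup_AE[of "\<lambda>x. ereal \<bar>f x\<bar>" ?L]
  proof eventually_elim
    case (elim x)
    then have "ereal \<bar>f x\<bar> < ereal M" using M by (rule le_less_trans)
    then show ?case by simp
  qed
  have "AE x in ?L. ereal (ln c) \<le> ?g x"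
    using cf
  proof eventually_elim
    case (elim x) then show ?case using c(1) by auto
  qed
  then have "ereal (ln c) \<le> essinf ?L ?g"
    using gm by (simp add: essinf_def Liminf_bounded)
  moreover have "AE x in ?L. ?g x \<le> ereal (ln M)"
    using cf fM
  proof eventually_elim
    case (elim x) then show ?case using c(1) by auto
  qed
  then have "esssup ?L ?g \<le> ereal (ln M)"
    using gm by (intro esssup_I)
  moreover have le: "essinf ?L ?g \<le> esssup ?L ?g"
    using gm nb by (simp add: essinf_def esssup_def Liminf_le_Limsup)
  \<comment> \<open>Both essential bounds lie between \<open>ln c\<close> and \<open>ln M\<close>,
    so they are real numbers and can serve as truncation levels.\<close>
  ultimately obtain a b where ab: "essinf ?L ?g = ereal a" "esssup ?L ?g = ereal b"
    by (cases "essinf ?L ?g"; cases "esssup ?L ?g") auto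
  have "AE x in ?L. 0 < f x \<and> a \<le> ln (f x) \<and> ln (f x) \<le> b"
    using cf AE_essinf_le[of ?L ?g] esssup_AE[of ?g ?L] unfolding ab
  proof eventually_elim
    case (elim x) then show ?case using c(1) by auto
  qed
  from log_energy_minimizer_exists[OF assms(1,4) fm this, of l\<^sub>0] le
  show ?thesis unfolding ab by auto
qed

end
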